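(* (Unreduced case) Suppose that the unreduced Burau representation $\beta_{4,u}$ of $B_4$ is faithful. Then there is an element $A\in\overline{\Gamma_4}$ that commutes with $\overline{\beta_{4,u}}\left((\sigma_3\sigma_2\sigma_3)^2\right)$ and lies outside the image $\overline{\beta_{4,u}}(B_4)$. (Reduced case) Suppose that the reduced Burau representation $\beta_{4,r}$ of $B_4$ is faithful. Then there is an element $A\in\overline{\Gamma_4'}$ that commutes with $\overline{\beta_{4,r}}\left((\sigma_3\sigma_2\sigma_3)^2\right)$ and lies outside the image $\overline{\beta_{4,r}}(B_4)$.
   Context: Let $\Lambda=\mathbb{Z}[t,t^{-1}]$. $B_n$ is the braid group with standard generators $\sigma_1,\dots,\sigma_{n-1}$. The unreduced Burau representation $\beta_{n,u}:B_n\to \mathrm{GL}(n,\Lambda)$ sends $\sigma_i$ to the block diagonal matrix $I_{i-1}\oplus\begin{pmatrix}1-t&t\\1&0\end{pmatrix}\oplus I_{n-i-1}$. The reduced Burau representation $\beta_{n,r}:B_n\to\mathrm{GL}(n-1,\Lambda)$ sends $\sigma_i$ to the matrix that agrees with $I_{n-1}$ except in row $i$, whose $(i,i-1)$, $(i,i)$, $(i,i+1)$ entries are $t,\,-t,\,1$ respectively (entries with column index outside $1,\dots,n-1$ are omitted), all other entries of row $i$ being $0$. For a matrix $A$ over $\Lambda$, $\overline{A}$ is obtained by applying $t\mapsto t^{-1}$ to each entry. Let $J_n$ be the $n\times n$ matrix with $1$ on the diagonal, $-t^{-1}$ in every entry above the diagonal and $-t$ in every entry below the diagonal. Let $v_n=(t,t^2,\dots,t^n)$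 (row vector) and $\overrightarrow{1_n}=(1,\dots,1)^T$. Define $$\Gamma_n=\{A\in\mathrm{GL}(n,\Lambda): v_nA=v_n,\ A\overrightarrow{1_n}=\overrightarrow{1_n},\ \overline{A}J_nA^T=J_n,\ A|_{t=1}\in S_n\},$$ where $S_n$ is the group of $n\times n$ permutation matrices. One has $\beta_{n,u}(B_n)\subset\Gamma_n$. $\Gamma_n'\subset \mathrm{GL}(n-1,\Lambda)$ is the image of $\Gamma_n$ under restriction to the orthogonal complement, with respect to the Hermitian form determined by $J_n$, of the fixed vector. Explicitly, for the action on column vectors, this complement is the free $\Lambda$-module $\{y\in\Lambda^n: v_ny=0\}$ with basis $w_i=t^{1-i}e_i-t^{-i}e_{i+1}$, $1\le i\le n-1$, and $\Gamma_n'$ is the group of matrices, in this basis, of the restrictions of the elements of $\Gamma_n$; in this basis the restriction of $\beta_{n,u}(\sigma_i)$ is $\beta_{n,r}(\sigma_i)$, so $\beta_{n,r}(B_n)\subset\Gamma_n'$. $\overline{\Gamma_n}$ (resp. $\overline{\Gamma_n'}$) is the quotient of $\Gamma_n$ (resp. $\Gamma_n'$) by its center, and $\overline{\beta_{n,u}}:B_n\to\overline{\Gamma_n}$ (resp. $\overline{\beta_{n,r}}:B_n\to\overline{\Gamma_n'}$) is the composition of $\beta_{n,u}$ (resp. $\beta_{n,r}$) with the quotient map. *)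

theory Defs
  imports
    "HOL-Library.Poly_Mapping"
    "HOL-Combinatorics.Permutations"
    "HOL-Algebra.Coset"
    "Jordan_Normal_Form.Matrix"
begin

section \<open>The braid group\<close>

text \<open>The letter \<open>(i, True)\<close> stands for the generator \<open>\<sigma>\<^sub>i\<close> and \<open>(i, False)\<close> for its inverse.\<close>

type_synonym braid_word = "(nat \<times> bool) list"

definition braid_words :: "nat \<Rightarrow> braid_word set" where
  "braid_words n = lists ({1..<n} \<times> UNIV)"

inductive braid_eq :: "nat \<Rightarrow> braid_word \<Rightarrow> braid_word \<Rightarrow> bool" for n where
  refl: "braid_eq n u u"
| sym: "braid_eq n u v \<Longrightarrow> braid_eq n v u"
| trans: "braid_eq n u v \<Longrightarrow> braid_eq n v w \<Longrightarrow> braid_eq n u w"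
| congr: "braid_eq n u v \<Longrightarrow> braid_eq n (x @ u @ y) (x @ v @ y)"
| cancel: "i \<in> {1..<n} \<Longrightarrow> braid_eq n [(i, b), (i, \<not> b)] []"
| far: "i \<in> {1..<n} \<Longrightarrow> j \<in> {1..<n} \<Longrightarrow> i + 2 \<le> j \<Longrightarrow>
    braid_eq n [(i, True), (j, True)] [(j, True), (i, True)]"
| braid: "i \<in> {1..<n} \<Longrightarrow> Suc i \<in> {1..<n} \<Longrightarrow>
    braid_eq n [(i, True), (Suc i, True), (i, True)] [(Suc i, True), (i, True), (Suc i, True)]"

definition braid_rel :: "nat \<Rightarrow> (braid_word \<times> braid_word) set" where
  "braid_rel n = {(u, v). u \<in> braid_words n \<and> v \<in> braid_words n \<and> braid_eq n u v}"

definition braid_group :: "nat \<Rightarrow> braid_word set monoid" where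
  "braid_group n =
    \<lparr>carrier = braid_words n // braid_rel n,
     monoid.mult = (\<lambda>X Y. \<Union>x\<in>X. \<Union>y\<in>Y. braid_rel n `` {x @ y}),
     one = braid_rel n `` {[]}\<rparr>"

definition sigma :: "nat \<Rightarrow> nat \<Rightarrow> braid_word set" where
  "sigma n i = braid_rel n `` {[(i, True)]}"


section \<open>Matrices over the integral Laurent polynomials\<close>

text \<open>The group ring of the additive group of integers, that is, \<open>\<int>[t, t\<^sup>-\<^sup>1]\<close>:
  an element is the finitely supported family of its coefficients, and the
  multiplication of \<open>\<Rightarrow>\<^sub>0\<close> is convolution.\<close>

type_synonym laurent = "int \<Rightarrow>\<^sub>0 int"

definition tpow :: "int \<Rightarrow> laurent" where
  "tpow k = Poly_Mapping.single k 1"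

definition laurent_bar :: "laurent \<Rightarrow> laurent" where
  "laurent_bar p = Poly_Mapping.map_key uminus p"

definition laurent_at_1 :: "laurent \<Rightarrow> int" where
  "laurent_at_1 p = (\<Sum>k\<in>Poly_Mapping.keys p. Poly_Mapping.lookup p k)"

text \<open>Matrices of \<open>Jordan_Normal_Form\<close> are indexed from 0; the following constructor
  takes the entries as a function of indices starting from 1.\<close>

definition mat1 :: "nat \<Rightarrow> nat \<Rightarrow> (nat \<Rightarrow> nat \<Rightarrow> 'a) \<Rightarrow> 'a mat" where
  "mat1 m n f = mat m n (\<lambda>(r, c). f (Suc r) (Suc c))"

definition GL :: "nat \<Rightarrow> laurent mat monoid" where
  "GL n = units_of (ring_mat TYPE(laurent) n ())"

definition permutation_matrices :: "nat \<Rightarrow> int mat set" where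
  "permutation_matrices n =
    {mat n n (\<lambda>(r, c). if r = \<pi> c then 1 else 0) | \<pi>. \<pi> permutes {..<n}}"


section \<open>The Burau representations\<close>

definition burau_u_gen :: "nat \<Rightarrow> nat \<Rightarrow> laurent mat" where
  "burau_u_gen n i =
    diag_block_mat
      [1\<^sub>m (i - 1),
       mat_of_rows_list 2 [[1 - tpow 1, tpow 1], [1, 0]],
       1\<^sub>m (n - i - 1)]"

definition burau_r_gen :: "nat \<Rightarrow> nat \<Rightarrow> laurent mat" where
  "burau_r_gen n i =
    mat1 (n - 1) (n - 1) (\<lambda>r c.
      if r = i then
        (if c + 1 = i then tpow 1 else if c = i then - tpow 1 else if c = i + 1 then 1 else 0)
      else if r = c then 1 else 0)"

definition word_eval :: "('a, 'b) monoid_scheme \<Rightarrow> (nat \<Rightarrow> 'a) \<Rightarrow> braid_word \<Rightarrow> 'a" where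
  "word_eval G f w =
    foldr (\<lambda>(i, b) x. (if b then f i else inv\<^bsub>G\<^esub> (f i)) \<otimes>\<^bsub>G\<^esub> x) w \<one>\<^bsub>G\<^esub>"

text \<open>The Burau matrices satisfy the braid relations, so evaluation of words is constant
  on each element \<open>X\<close> of the braid group and the images below are singletons.\<close>

definition burau_u :: "nat \<Rightarrow> braid_word set \<Rightarrow> laurent mat" where
  "burau_u n X = the_elem (word_eval (GL n) (burau_u_gen n) ` X)"

definition burau_r :: "nat \<Rightarrow> braid_word set \<Rightarrow> laurent mat" where
  "burau_r n X = the_elem (word_eval (GL (n - 1)) (burau_r_gen n) ` X)"


section \<open>The groups containing the images\<close>

definition J_mat :: "nat \<Rightarrow> laurent mat" where
  "J_mat n = mat1 n n (\<lambda>r c. if r = c then 1 else if r < c then - tpow (- 1) else - tpow 1)"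

definition v_row :: "nat \<Rightarrow> laurent mat" where
  "v_row n = mat1 1 n (\<lambda>_ c. tpow (int c))"

definition ones_col :: "nat \<Rightarrow> laurent mat" where
  "ones_col n = mat1 n 1 (\<lambda>_ _. 1)"

definition Gamma :: "nat \<Rightarrow> laurent mat monoid" where
  "Gamma n = (GL n)\<lparr>carrier := {A \<in> carrier (GL n).
     v_row n * A = v_row n \<and>
     A * ones_col n = ones_col n \<and>
     map_mat laurent_bar A * J_mat n * transpose_mat A = J_mat n \<and>
     map_mat laurent_at_1 A \<in> permutation_matrices n}\<rparr>"

text \<open>The columns of \<open>W_mat n\<close> are the vectors \<open>w\<^sub>i = t\<^sup>1\<^sup>-\<^sup>i e\<^sub>i - t\<^sup>-\<^sup>i e\<^sub>i\<^sub>+\<^sub>1\<close> (\<open>1 \<le> i \<le> n - 1\<close>), a basis of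
  the kernel of \<open>v_row n\<close>, which is the orthogonal complement of the fixed vector. Hence
  \<open>A * W_mat n = W_mat n * B\<close> says that \<open>B\<close> is the matrix, in this basis, of the restriction
  of the action of \<open>A\<close> on column vectors.\<close>

definition W_mat :: "nat \<Rightarrow> laurent mat" where
  "W_mat n = mat1 n (n - 1) (\<lambda>r i.
     if r = i then tpow (1 - int i) else if r = i + 1 then - tpow (- int i) else 0)"

definition Gamma_red :: "nat \<Rightarrow> laurent mat monoid" where
  "Gamma_red n = (GL (n - 1))\<lparr>carrier := {B \<in> carrier (GL (n - 1)).
     \<exists>A\<in>carrier (Gamma n). A * W_mat n = W_mat n * B}\<rparr>"


section \<open>Quotients by the centers\<close>

definition group_center :: "('a, 'b) monoid_scheme \<Rightarrow> 'a set" where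
  "group_center G = {z \<in> carrier G. \<forall>g\<in>carrier G. z \<otimes>\<^bsub>G\<^esub> g = g \<otimes>\<^bsub>G\<^esub> z}"

definition central_quotient :: "('a, 'b) monoid_scheme \<Rightarrow> 'a set monoid" where
  "central_quotient G = G Mod group_center G"

definition to_central_quotient :: "('a, 'b) monoid_scheme \<Rightarrow> 'a \<Rightarrow> 'a set" where
  "to_central_quotient G a = group_center G #>\<^bsub>G\<^esub> a"

definition burau_u_bar :: "nat \<Rightarrow> braid_word set \<Rightarrow> laurent mat set" where
  "burau_u_bar n X = to_central_quotient (Gamma n) (burau_u n X)"

definition burau_r_bar :: "nat \<Rightarrow> braid_word set \<Rightarrow> laurent mat set" where
  "burau_r_bar n X = to_central_quotient (Gamma_red n) (burau_r n X)"

end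

theory Submission
  imports Defs
begin

text \<open>Let \<open>x = (\<sigma>\<^sub>3 \<sigma>\<^sub>2 \<sigma>\<^sub>3)\<^sup>2\<close>, the full twist on the last three strands. On the Burau module, the
kernel of \<open>v\<close> with basis \<open>w\<^sub>1, w\<^sub>2, w\<^sub>3\<close>, it multiplies \<open>w\<^sub>2\<close> and \<open>w\<^sub>3\<close> by \<open>t\<^sup>3\<close>. Every vector \<open>r\<close> of the Burau
module whose norm for the Hermitian form is that of the \<open>w\<^sub>i\<close> (a root) defines a unitary reflection
with \<open>r \<mapsto> - t r\<close>, and the generators \<open>\<sigma>\<^sub>i\<close> act as the reflections in the \<open>w\<^sub>i\<close>. The witness is the
reflection in a root \<open>p w\<^sub>2 + q w\<^sub>3\<close>, where \<open>p\<close> and \<open>q\<close> are explicit polynomials of degree 10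
(\<open>exotic\<close>). It lies in \<open>\<Gamma>\<^sub>4\<close> by \<open>refl_root_Gamma\<close>, and it commutes with the image of \<open>x\<close>, since the root
is an eigenvector of \<open>x\<close>.\<close>

text \<open>Suppose that it is a central element \<open>z\<close> times the image of a braid \<open>g\<close>. Then the image of \<open>g\<close>
commutes with that of \<open>x\<close>, so \<open>g\<close> commutes with \<open>x\<close> by faithfulness, and this determines \<open>g\<close> well
enough. The braid group is the semidirect product of a free group on two elements \<open>a\<close>, \<open>b\<close> and the
subgroup generated by \<open>\<sigma>\<^sub>2\<close>, \<open>\<sigma>\<^sub>3\<close>, so \<open>g = f c\<close> accordingly (\<open>split_word\<close>). As \<open>c\<close> commutes with \<open>x\<close>, so
does \<open>f\<close>; and \<open>x\<^sup>2\<close> acts on the free group as conjugation by a commutator of \<open>a\<close> and \<open>b\<close>. Hence \<open>f\<close>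
is a power of that commutator (\<open>kernel_part_of_centralizer\<close>), and powers of it multiply \<open>w\<^sub>2\<close> and \<open>w\<^sub>3\<close> by
a scalar. A central element also acts on the Burau module as a scalar (\<open>central_scalar\<close>). So the witness
would map \<open>w\<^sub>2\<close> to a multiple of the image of \<open>w\<^sub>2\<close> under a word \<open>c\<close> in \<open>\<sigma>\<^sub>2\<close> and \<open>\<sigma>\<^sub>3\<close>.\<close>

text \<open>This is impossible already after putting \<open>t = 3\<close>. Up to scalars, \<open>\<sigma>\<^sub>2 \<sigma>\<^sub>3 \<sigma>\<^sub>2\<close> has order 2 and \<open>\<sigma>\<^sub>2 \<sigma>\<^sub>3\<close>
has order 3 on the plane spanned by \<open>w\<^sub>2\<close> and \<open>w\<^sub>3\<close>, and a ping-pong argument confines the orbit of \<open>w\<^sub>2\<close>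
to three cones (\<open>reach_three_word\<close>); the image of \<open>w\<^sub>2\<close> under the witness is outside
them (\<open>exotic_not_reach\<close>). Both parts of the theorem follow from this one argument, since the reduced and
the unreduced representation contain the same Burau module (\<open>burau_model\<close>).\<close>

section \<open>The free group of rank two\<close>

type_synonym letter = "bool \<times> bool"

text \<open>A letter \<open>(False, s)\<close> is the generator \<open>a\<close> or its inverse, and \<open>(True, s)\<close> is \<open>b\<close> or its inverse; the
generators themselves have \<open>s = True\<close>.\<close>

definition flip :: "letter \<Rightarrow> letter" where
  "flip l = (fst l, \<not> snd l)"

definition reduced :: "letter list \<Rightarrow> bool" where
  "reduced w = successively (\<lambda>x y. y \<noteq> flip x) w"

definition push :: "letter \<Rightarrow> letter list \<Rightarrow> letter list" where
  "push l w = (case w of [] \<Rightarrow> [l] | m # w' \<Rightarrow> if m = flip l then w' else l # w)"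

lemma flip_flip [simp]: "flip (flip l) = l"
  by (simp add: flip_def)

lemma flip_neq [simp]: "l \<noteq> flip l"
  by (cases l) (simp add: flip_def)

lemma reduced_Nil [simp]: "reduced []"
  by (simp add: reduced_def)

lemma reduced_Cons: "reduced (l # w) \<longleftrightarrow> reduced w \<and> (w = [] \<or> hd w \<noteq> flip l)"
  by (cases w) (auto simp: reduced_def)

lemma reduced_push: "reduced w \<Longrightarrow> reduced (push l w)"
  by (cases w) (auto simp: push_def reduced_Cons)

lemma push_flip_push: "reduced w \<Longrightarrow> push (flip l) (push l w) = w"
  by (cases w) (auto simp: push_def reduced_Cons split: list.split)

lemma reduced_foldr_push: "reduced w \<Longrightarrow> reduced (foldr push u w)"
  by (induction u) (auto intro: reduced_push)

lemma foldr_push_Nil: "reduced u \<Longrightarrow> foldr push u [] = u"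
  by (induction u) (auto simp: reduced_Cons push_def split: list.split)

text \<open>The one case in which \<open>push l r\<close> is not simply \<open>l # r\<close> is a cancellation, which \<open>push_flip_push\<close> undoes
after the multiplication by \<open>w\<close>. This makes the product of reduced words associative.\<close>

lemma foldr_push_push:
  assumes "reduced r" "reduced w"
  shows "foldr push (push l r) w = push l (foldr push r w)"
proof (cases "r \<noteq> [] \<and> hd r = flip l")
  case True
  then obtain r' where r: "r = flip l # r'" by (cases r) auto
  show ?thesis
    using push_flip_push[OF reduced_foldr_push[OF assms(2)], of "flip l" r'] by (simp add: r push_def)
next
  case False
  then show ?thesis by (cases r) (auto simp: push_def)
qed

lemma foldr_push_assoc:
  assumes "reduced v" "reduced w"
  shows "foldr push (foldr push u v) w = foldr push u (foldr push v w)"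
  using assms by (induction u) (simp_all add: foldr_push_push reduced_foldr_push)

lemma foldr_push_inverse: "reduced w \<Longrightarrow> foldr push (rev (map flip u)) (foldr push u w) = w"
  by (induction u) (simp_all add: push_flip_push reduced_foldr_push)

lemma length_foldr_push: "length (foldr push u w) \<le> length u + length w"
  by (induction u) (auto simp: push_def split: list.split)

text \<open>A product of reduced words that is as long as both together involved no cancellation.\<close>

lemma foldr_push_eq_append:
  assumes "length (foldr push u w) = length u + length w"
  shows "foldr push u w = u @ w"
  using assms
proof (induction u)
  case (Cons l u)
  have push: "push l v = l # v \<or> length (push l v) < Suc (length v)" for v
    by (auto simp: push_def split: list.split)
  with Cons.prems length_foldr_push[of u w] have "push l (foldr push u w) = l # foldr push u w"
    by (metis (no_types, lifting) add_Suc foldr.simps(2) comp_apply leD le_imp_less_Suc length_Cons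
        less_le_trans not_less_eq)
  with Cons show ?case by simp
qed simp

text \<open>The group is written additively because \<open>group_add\<close> is the type class of groups that need not be
commutative.\<close>

typedef free2 = "{w. reduced w}"
  by (rule exI[of _ "[]"]) simp

setup_lifting type_definition_free2

instantiation free2 :: group_add
begin

lift_definition zero_free2 :: free2 is "[]" by simp
lift_definition plus_free2 :: "free2 \<Rightarrow> free2 \<Rightarrow> free2" is "foldr push"
  by (rule reduced_foldr_push)
lift_definition uminus_free2 :: "free2 \<Rightarrow> free2" is "\<lambda>w. foldr push (rev (map flip w)) []"
  by (rule reduced_foldr_push) simp
definition minus_free2 :: "free2 \<Rightarrow> free2 \<Rightarrow> free2" where "minus_free2 u v = u + - v"

instance
proof
  fix a b c :: free2
  show "a + b + c = a + (b + c)" by transfer (rule foldr_push_assoc)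
  show "0 + a = a" by transfer simp
  show "a + 0 = a" by transfer (rule foldr_push_Nil)
  show "- a + a = 0"
    by transfer (metis foldr_push_Nil foldr_push_assoc foldr_push_inverse reduced_Nil foldr.simps(1) id_apply)
  show "a + - b = a - b" by (simp add: minus_free2_def)
qed

end

lift_definition letter :: "letter \<Rightarrow> free2" is "\<lambda>l. [l]"
  by (simp add: reduced_Cons)

definition word_value :: "letter list \<Rightarrow> free2" where
  "word_value w = foldr (\<lambda>l g. letter l + g) w 0"

lemma Rep_letter_plus: "Rep_free2 (letter l + g) = push l (Rep_free2 g)"
  by transfer simp

lemma letter_flip: "letter (flip l) = - letter l"
  by transfer (simp add: push_def)

lemma Rep_word_value: "Rep_free2 (word_value w) = foldr push w []"
  by (induction w) (simp_all add: word_value_def Rep_letter_plus zero_free2.rep_eq)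

lemma reduced_Rep [simp]: "reduced (Rep_free2 g)"
  using Rep_free2 by simp

text \<open>The centre is trivial: if \<open>z\<close> is not trivial and \<open>g\<close> is a generator that
  differs from the first letter of \<open>z\<close> and from its inverse, then \<open>g z\<close> and \<open>z g\<close> begin with different letters.\<close>

lemma center_free2:
  assumes comm: "\<And>i. letter (i, True) + z = z + letter (i, True)"
  shows "z = 0"
proof (rule ccontr)
  assume "z \<noteq> 0"
  then have "Rep_free2 z \<noteq> []"
    by transfer simp
  then obtain l w where z: "Rep_free2 z = l # w" by (cases "Rep_free2 z") auto
  let ?g = "(\<not> fst l, True)"
  have "foldr push (Rep_free2 z) [?g] = push ?g (Rep_free2 z)"
    using arg_cong[OF comm[of "\<not> fst l"], of Rep_free2] by (simp add: plus_free2.rep_eq letter.rep_eq)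
  also have "\<dots> = ?g # Rep_free2 z"
    by (cases l) (auto simp: z push_def flip_def)
  finally have eq: "foldr push (Rep_free2 z) [?g] = ?g # Rep_free2 z" .
  then have "foldr push (Rep_free2 z) [?g] = Rep_free2 z @ [?g]"
    by (intro foldr_push_eq_append) simp
  with eq z show False
    by (cases l) auto
qed

text \<open>The commutator \<open>a b\<^sup>-\<^sup>1 a\<^sup>-\<^sup>1 b\<close>, which equals the full twist on four strands divided by the square of
the full twist on the last three.\<close>

definition comm_word :: "letter list" where
  "comm_word = [(False, True), (True, False), (False, False), (True, True)]"

inductive comm_power :: "letter list \<Rightarrow> bool" where
  "comm_power []"
| "comm_power w \<Longrightarrow> comm_power (foldr push comm_word w)"
| "comm_power w \<Longrightarrow> comm_power (foldr push (rev (map flip comm_word)) w)"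

text \<open>If \<open>k\<close> and \<open>w\<close> commute and \<open>k w\<close> is free of cancellation, then so is \<open>w k\<close>, because both have the same
length. So \<open>w k = k w\<close> as words, and \<open>w\<close> begins with \<open>k\<close> unless it is shorter than \<open>k\<close>; the proper nonempty
prefixes of \<open>k\<close> do not commute with \<open>k\<close>.\<close>

lemma comm_prefix:
  assumes k: "k = comm_word \<or> k = rev (map flip comm_word)"
    and w: "w \<noteq> []"
    and eq: "foldr push w k = k @ w"
  shows "\<exists>w'. w = k @ w'"
proof -
  have k4: "length k = 4" using k by (auto simp: comm_word_def)
  have "foldr push w k = w @ k"
    using eq by (intro foldr_push_eq_append) simp
  then have wk: "w @ k = k @ w" using eq by simp
  show ?thesis
  proof (cases "4 \<le> length w")
    case True
    have "take 4 (w @ k) = take 4 (k @ w)" using wk by simp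
    then have "take 4 w = k" using True k4 by simp
    then show ?thesis by (metis append_take_drop_id)
  next
    case False
    moreover have "0 < length w" using w by simp
    ultimately consider "length w = 1" | "length w = 2" | "length w = 3"
      by linarith
    then show ?thesis
      using wk k by (cases; auto simp: comm_word_def flip_def length_Suc_conv numeral_eq_Suc)
  qed
qed

text \<open>The centraliser of the commutator. Cancellation is impossible either between the commutator and \<open>w\<close>
  or between its inverse and \<open>w\<close>, since these two end with letters of different generators; whichever it is,
  \<open>comm_prefix\<close> then splits it off from \<open>w\<close>.\<close>

lemma centralizer_commutator:
  assumes "reduced w" and "foldr push w comm_word = foldr push comm_word w"
  shows "comm_power w"
  using assms
proof (induction "length w" arbitrary: w rule: less_induct)
  case less
  let ?K = comm_word and ?K' = "rev (map flip comm_word)"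
  have redK: "reduced ?K" "reduced ?K'"
    by (auto simp: comm_word_def flip_def reduced_Cons)
  have comm': "foldr push w ?K' = foldr push ?K' w"
  proof -
    have 1: "foldr push ?K' ?K = []"
      by (simp add: comm_word_def push_def flip_def)
    have 2: "foldr push ?K ?K' = []"
      by (simp add: comm_word_def push_def flip_def)
    have "foldr push ?K' w = foldr push ?K' (foldr push w [])"
      using less.prems(1) by (simp add: foldr_push_Nil)
    also have "\<dots> = foldr push ?K' (foldr push w (foldr push ?K ?K'))"
      by (simp only: 2)
    also have "\<dots> = foldr push ?K' (foldr push (foldr push w ?K) ?K')"
      by (simp only: foldr_push_assoc[OF redK])
    also have "\<dots> = foldr push ?K' (foldr push (foldr push ?K w) ?K')"
      by (simp only: less.prems(2))
    also have "\<dots> = foldr push ?K' (foldr push ?K (foldr push w ?K'))"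
      by (simp only: foldr_push_assoc[OF less.prems(1) redK(2)])
    also have "\<dots> = foldr push w ?K'"
      by (simp add: foldr_push_inverse reduced_foldr_push redK)
    finally show ?thesis by simp
  qed
  have step: "comm_power w"
    if k: "k = ?K \<and> k' = ?K' \<or> k = ?K' \<and> k' = ?K"
      and comm: "foldr push w k = foldr push k w"
      and nocancel: "foldr push k w = k @ w" and "w \<noteq> []" for k k'
  proof -
    obtain w' where w': "w = k @ w'"
      using comm_prefix[of k w] k comm nocancel \<open>w \<noteq> []\<close> by auto
    have redw': "reduced w'"
      using less.prems(1) by (auto simp: w' reduced_def successively_append_iff)
    have redk: "reduced k" "reduced k'" using k redK by auto
    have kw': "foldr push k w' = w"
      using foldr_push_Nil[OF less.prems(1)] foldr_push_Nil[OF redw'] by (simp add: w')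
    have kk': "foldr push k' (foldr push k u) = u" if "reduced u" for u
    proof -
      have "k' = rev (map flip k)" using k by (auto simp: comm_word_def flip_def)
      then show ?thesis using foldr_push_inverse[OF that] by simp
    qed
    have "foldr push w' k = foldr push (foldr push k' w) k"
      using kk'[OF redw'] kw' by simp
    also have "\<dots> = foldr push k' (foldr push w k)"
      using foldr_push_assoc less.prems(1) redk by simp
    also have "\<dots> = w"
      using comm kk' less.prems(1) by simp
    finally have c1: "foldr push w' k = foldr push k w'" using kw' by simp
    have "foldr push w' ?K = foldr push ?K w'"
    proof (cases "k = ?K")
      case True then show ?thesis using c1 by simp
    next
      case False
      then have kk: "k = ?K'" "k' = ?K" using k by auto
      have i2: "foldr push ?K' (foldr push ?K u) = u" if "reduced u" for u
        using foldr_push_inverse[OF that] by simp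
      have "foldr push ?K w' = foldr push ?K (foldr push w' (foldr push ?K' ?K))"
        using foldr_push_Nil[OF redw'] i2[of "[]"] foldr_push_Nil[OF redK(1)] by simp
      also have "\<dots> = foldr push ?K (foldr push (foldr push w' ?K') ?K)"
        by (simp add: foldr_push_assoc redK)
      also have "\<dots> = foldr push ?K (foldr push ?K' (foldr push w' ?K))"
        using c1 kk by (simp add: foldr_push_assoc redK redw')
      also have "\<dots> = foldr push w' ?K"
        using kk'[OF reduced_foldr_push[OF redK(1)]] kk by simp
      finally show ?thesis by simp
    qed
    moreover have "length w' < length w"
      using k by (auto simp: w' comm_word_def)
    ultimately have "comm_power w'"
      using less.hyps redw' by blast
    then have "comm_power (foldr push k w')"
      using k comm_power.intros by auto
    then show ?thesis by (simp add: kw')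
  qed
  show ?case
  proof (cases "w = []")
    case True
    then show ?thesis by (simp add: comm_power.intros)
  next
    case False
    show ?thesis
    proof (cases "hd w = (True, False)")
      case True
      have "foldr push ?K' w = ?K' @ w"
        using True False by (cases w) (auto simp: comm_word_def push_def flip_def)
      then show ?thesis using step[of ?K' ?K] comm' False by auto
    next
      case F: False
      have "foldr push ?K w = ?K @ w"
        using F False by (cases w) (auto simp: comm_word_def push_def flip_def)
      then show ?thesis using step[of ?K ?K'] less.prems(2) False by auto
    qed
  qed
qed

section \<open>Actions of the braid group on four strands\<close>

text \<open>\<open>foldr M w\<close> is the map by which the word \<open>w\<close> acts when \<open>M\<close> says how the letters act.\<close>

locale braid_action =
  fixes M :: "nat \<times> bool \<Rightarrow> 'x \<Rightarrow> 'x"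
  assumes act_cancel: "i \<in> {1,2,3} \<Longrightarrow> M (i, b) (M (i, \<not> b) v) = v"
    and act_far: "M (1, True) (M (3, True) v) = M (3, True) (M (1, True) v)"
    and act_braid: "M (1, True) (M (2, True) (M (1, True) v)) = M (2, True) (M (1, True) (M (2, True) v))"
      "M (2, True) (M (3, True) (M (2, True) v)) = M (3, True) (M (2, True) (M (3, True) v))"
begin

lemma braid_eq_imp_eq: "braid_eq 4 u v \<Longrightarrow> foldr M u = foldr M v"
proof (induction rule: braid_eq.induct)
  case (far i j)
  then have "i = 1" "j = 3" by auto
  then show ?case by (simp add: fun_eq_iff act_far del: One_nat_def)
next
  case (braid i)
  then consider "i = 1" "Suc i = 2" | "i = 2" "Suc i = 3" by force
  then show ?case by cases (simp_all only: foldr.simps comp_apply id_apply fun_eq_iff act_braid simp_thms)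
next
  case (cancel i b)
  then have "i \<in> {1,2,3}" by auto
  then show ?case by (auto simp add: fun_eq_iff act_cancel)
qed simp_all

end

text \<open>The kernel of the homomorphism from the braid group on four strands to the one on three
  strands that identifies \<open>\<sigma>\<^sub>1\<close> with \<open>\<sigma>\<^sub>3\<close> is generated by
  \<open>a = \<sigma>\<^sub>1 \<sigma>\<^sub>3\<^sup>-\<^sup>1\<close> and \<open>b = \<sigma>\<^sub>2 a \<sigma>\<^sub>2\<^sup>-\<^sup>1\<close>.\<close>

definition kernel_letter :: "letter \<Rightarrow> braid_word" where
  "kernel_letter l =
    (let a = (if snd l then [(1, True), (3, False)] else [(3, True), (1, False)])
     in if fst l then [(2, True)] @ a @ [(2, False)] else a)"

definition kernel_word :: "letter list \<Rightarrow> braid_word" where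
  "kernel_word f = concat (map kernel_letter f)"

text \<open>Conjugation of \<open>a\<close> and \<open>b\<close> by \<open>\<sigma>\<^sub>2\<close>, \<open>\<sigma>\<^sub>3\<close> and their inverses.\<close>

fun conj_letter :: "nat \<times> bool \<Rightarrow> letter \<Rightarrow> letter list" where
  "conj_letter (i, s) (g, e) =
    (let w = (if i = 2 then
           (if s then (if g then [(True, True), (False, False), (True, True)] else [(True, True)])
            else (if g then [(False, True)] else [(False, True), (True, False), (False, True)]))
         else
           (if g then [(False, \<not> s), (True, True)] else [(False, True)]))
     in if e then w else rev (map flip w))"

definition free_conj :: "nat \<times> bool \<Rightarrow> letter list \<Rightarrow> letter list" where
  "free_conj l f = concat (map (conj_letter l) f)"

text \<open>Moving the letters \<open>\<sigma>\<^sub>2\<close>, \<open>\<sigma>\<^sub>3\<close> to the right across words in \<open>a\<close>, \<open>b\<close>, and writing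
  \<open>\<sigma>\<^sub>1 = a \<sigma>\<^sub>3\<close>, turns a word into a word in \<open>a\<close>, \<open>b\<close> followed by a word in \<open>\<sigma>\<^sub>2\<close>, \<open>\<sigma>\<^sub>3\<close>.\<close>

fun kernel_part :: "braid_word \<Rightarrow> letter list" where
  "kernel_part [] = []"
| "kernel_part ((i, s) # w) =
    (if i = 1 then (False, s) # free_conj (3, s) (kernel_part w) else free_conj (i, s) (kernel_part w))"

definition three_part :: "braid_word \<Rightarrow> braid_word" where
  "three_part w = map (\<lambda>(i, s). (if i = 1 then 3 else i, s)) w"

text \<open>The relations \<open>conj\<close> hold in the braid group itself. They are assumed here, since in a concrete action
each of them is a direct calculation.\<close>

locale split_braid_action = braid_action +
  assumes conj: "i \<in> {2,3} \<Longrightarrow>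
    M (i, s) (foldr M (kernel_letter l) v) = foldr M (kernel_word (conj_letter (i, s) l)) (M (i, s) v)"
begin

lemma foldr_kernel_word: "foldr M (kernel_word (f @ g)) v = foldr M (kernel_word f) (foldr M (kernel_word g) v)"
  by (simp add: kernel_word_def)

lemma conj_word:
  assumes "i \<in> {2,3}"
  shows "M (i, s) (foldr M (kernel_word f) v) = foldr M (kernel_word (free_conj (i, s) f)) (M (i, s) v)"
proof (induction f)
  case (Cons l f)
  have "M (i, s) (foldr M (kernel_word (l # f)) v)
      = M (i, s) (foldr M (kernel_letter l) (foldr M (kernel_word f) v))"
    by (simp add: kernel_word_def)
  also have "\<dots> = foldr M (kernel_word (free_conj (i, s) (l # f))) (M (i, s) v)"
    by (simp add: conj[OF assms] Cons.IH free_conj_def foldr_kernel_word[unfolded append.simps])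
  finally show ?case .
qed (simp add: kernel_word_def free_conj_def)

lemma split_word:
  assumes "w \<in> braid_words 4"
  shows "foldr M w v = foldr M (kernel_word (kernel_part w)) (foldr M (three_part w) v)"
  using assms
proof (induction w)
  case Nil
  then show ?case by (simp add: three_part_def kernel_word_def)
next
  case (Cons l w)
  obtain i s where l: "l = (i, s)" by (cases l)
  have i: "i \<in> {1,2,3}" and w: "w \<in> braid_words 4"
    using Cons.prems by (auto simp: braid_words_def l)
  note IH = Cons.IH[OF w]
  show ?case
  proof (cases "i = 1")
    case True
    \<comment> \<open>Moving \<open>\<sigma>\<^sub>3\<^sup>-\<^sup>1\<close> past \<open>\<sigma>\<^sub>1\<^sup>-\<^sup>1\<close> makes \<open>\<sigma>\<^sub>1\<^sup>-\<^sup>1 = a\<^sup>-\<^sup>1 \<sigma>\<^sub>3\<^sup>-\<^sup>1\<close> the same kind of equation as \<open>\<sigma>\<^sub>1 = a \<sigma>\<^sub>3\<close>.\<close>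
    have one: "M (1, s) u = foldr M (kernel_letter (False, s)) (M (3, s) u)" for u
    proof (cases s)
      case True
      then show ?thesis using act_cancel[of 3 False u] by (simp add: kernel_letter_def)
    next
      case False
      have "M (1, False) u = M (3, True) (M (3, False) (M (1, False) u))"
        using act_cancel[of 3 True "M (1, False) u"] by simp
      also have "M (3, False) (M (1, False) u) = M (1, False) (M (3, False) u)"
      proof -
        let ?y = "M (3, False) (M (1, False) u)"
        have "M (3, True) (M (1, True) ?y) = u"
          using act_far[of ?y] act_cancel[of 3 True "M (1, False) u"] act_cancel[of 1 True u] by simp
        then show ?thesis
          using act_cancel[of 3 False "M (1, True) ?y"] act_cancel[of 1 False ?y] by simp
      qed
      finally show ?thesis using False by (simp add: kernel_letter_def)
    qed
    show ?thesis
      using True IH conj_word[of 3 s "kernel_part w" "foldr M (three_part w) v"]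
      by (simp add: l one three_part_def kernel_word_def del: One_nat_def)
  next
    case False
    then show ?thesis
      using i IH conj_word[of i s "kernel_part w" "foldr M (three_part w) v"]
      by (simp add: l three_part_def)
  qed
qed

lemma kernel_letter_flip: "foldr M (kernel_letter (flip l)) (foldr M (kernel_letter l) v) = v"
  using act_cancel[of 1 True] act_cancel[of 1 False] act_cancel[of 2 True] act_cancel[of 2 False]
    act_cancel[of 3 True] act_cancel[of 3 False]
  by (cases l) (auto simp: kernel_letter_def flip_def Let_def simp del: One_nat_def)

lemma kernel_word_push: "foldr M (kernel_word (push l f)) v = foldr M (kernel_letter l) (foldr M (kernel_word f) v)"
proof (cases f)
  case (Cons m f')
  then show ?thesis
    using kernel_letter_flip[of "flip l"] by (simp add: push_def kernel_word_def)
qed (simp add: push_def kernel_word_def)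

lemma kernel_word_foldr_push:
  "foldr M (kernel_word (foldr push u f)) v = foldr M (kernel_word u) (foldr M (kernel_word f) v)"
  by (induction u) (simp_all add: kernel_word_push, simp_all add: kernel_word_def)

end

section \<open>The action by automorphisms of the free group\<close>

text \<open>The letter \<open>l\<close> maps \<open>(g, h)\<close> to the words \<open>l\<^sup>-\<^sup>1 a l\<close> and \<open>l\<^sup>-\<^sup>1 b l\<close> in \<open>a\<close>, \<open>b\<close>, evaluated at \<open>a = g\<close> and
\<open>b = h\<close>. Substitution reverses the order of composition, so \<open>l\<^sup>-\<^sup>1 _ l\<close>, and not
\<open>l _ l\<^sup>-\<^sup>1\<close>, gives an action. On the generators of the free group this action detects the elements of
the kernel: each of them acts by conjugation with its inverse (\<open>nielsen_kernel_word\<close>).\<close>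

fun nielsen :: "nat \<times> bool \<Rightarrow> 'g::group_add \<times> 'g \<Rightarrow> 'g \<times> 'g" where
  "nielsen (i, s) (g, h) =
    (if i = 1 then (if s then (g, h + g) else (g, h - g))
     else if i = 2 then (if s then (g - h + g, g) else (h, h - g + h))
     else (if s then (g, g + h) else (g, - g + h)))"

interpretation nielsen: split_braid_action "nielsen :: _ \<Rightarrow> 'g::group_add \<times> 'g \<Rightarrow> _"
proof (unfold_locales, goal_cases)
  case (1 i b v)
  then show ?case by (cases v; cases b) (auto simp: algebra_simps minus_add diff_conv_add_uminus simp del: add_uminus_conv_diff)
next
  case (2 v)
  then show ?case by (cases v) (auto simp: add.assoc)
next
  case (3 v)
  then show ?case by (cases v) (auto simp: add.assoc minus_add diff_conv_add_uminus simp del: add_uminus_conv_diff)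
next
  case (4 v)
  then show ?case by (cases v) (auto simp: add.assoc minus_add diff_conv_add_uminus simp del: add_uminus_conv_diff)
next
  case (5 i s l v)
  obtain p q where v: "v = (p, q)" by (cases v)
  obtain g e where l: "l = (g, e)" by (cases l)
  from 5 show ?case
    by (cases s; cases g; cases e; elim insertE)
      (simp_all add: v l kernel_word_def kernel_letter_def flip_def add.assoc minus_add diff_conv_add_uminus
        del: add_uminus_conv_diff)
qed

definition conj_pair :: "'g::group_add \<Rightarrow> 'g \<times> 'g \<Rightarrow> 'g \<times> 'g" where
  "conj_pair k v = (k + fst v - k, k + snd v - k)"

definition half_twist_sq :: braid_word where
  "half_twist_sq = [(3, True), (2, True), (3, True), (3, True), (2, True), (3, True)]"

lemma conj_pair_add: "conj_pair k (conj_pair l v) = conj_pair (k + l) v"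
  by (simp add: conj_pair_def diff_conv_add_uminus minus_add add.assoc del: add_uminus_conv_diff)

text \<open>Substitution commutes with the simultaneous conjugation of the arguments.\<close>

lemma nielsen_conj: "nielsen l (conj_pair k v) = conj_pair k (nielsen l v)"
  by (cases l; cases v)
    (auto simp: conj_pair_def diff_conv_add_uminus minus_add add.assoc simp del: add_uminus_conv_diff)

lemma foldr_nielsen_conj: "foldr nielsen w (conj_pair k v) = conj_pair k (foldr nielsen w v)"
  by (induction w) (simp_all add: nielsen_conj)

lemma nielsen_half_twist_sq_twice:
  "foldr nielsen half_twist_sq (foldr nielsen half_twist_sq (g, h)) = conj_pair (g - h - g + h) (g, h)"
  by (simp add: half_twist_sq_def conj_pair_def diff_conv_add_uminus minus_add add.assoc del: add_uminus_conv_diff)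

lemma nielsen_half_twist_commute:
  assumes "fst l \<in> {2,3}"
  shows "nielsen l (foldr nielsen half_twist_sq v) = foldr nielsen half_twist_sq (nielsen l v)"
  using assms
  by (cases l; cases v)
    (auto simp: half_twist_sq_def diff_conv_add_uminus minus_add add.assoc simp del: add_uminus_conv_diff)

lemma foldr_nielsen_half_twist_commute:
  assumes "fst ` set c \<subseteq> {2,3}"
  shows "foldr nielsen c (foldr nielsen half_twist_sq v) = foldr nielsen half_twist_sq (foldr nielsen c v)"
  using assms by (induction c) (simp_all add: nielsen_half_twist_commute)

lemma nielsen_kernel_word:
  "foldr nielsen (kernel_word f) (letter (False, True), letter (True, True))
    = conj_pair (- word_value f) (letter (False, True), letter (True, True))"
proof (induction f)
  case Nil
  then show ?case by (simp add: kernel_word_def word_value_def conj_pair_def)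
next
  case (Cons l f)
  have "foldr nielsen (kernel_letter l) (letter (False, True), letter (True, True))
      = conj_pair (- letter l) (letter (False, True), letter (True, True))"
    using letter_flip[of "(False, True)"] letter_flip[of "(True, True)"]
    by (cases l; cases "fst l"; cases "snd l")
      (auto simp: kernel_letter_def flip_def conj_pair_def Let_def diff_conv_add_uminus minus_add add.assoc
        simp del: add_uminus_conv_diff)
  then show ?case
    using Cons by (simp add: kernel_word_def word_value_def conj_pair_add foldr_nielsen_conj minus_add)
qed

lemma three_part_letters:
  assumes "w \<in> braid_words 4"
  shows "fst ` set (three_part w) \<subseteq> {2,3}"
proof -
  have "fst l \<in> {1,2,3}" if "l \<in> set w" for l
    using assms that by (fastforce simp: braid_words_def lists_eq_set)
  then show ?thesis by (fastforce simp: three_part_def)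
qed

lemma (in braid_action) surj_word:
  assumes "fst ` set c \<subseteq> {1,2,3}"
  shows "\<exists>u. foldr M c u = v"
  using assms
proof (induction c arbitrary: v)
  case (Cons l c)
  obtain u where "foldr M c u = M (fst l, \<not> snd l) v" using Cons by fastforce
  then have "foldr M (l # c) u = v" using act_cancel[of "fst l" "snd l" v] Cons.prems by simp
  then show ?case by blast
qed simp

text \<open>With \<open>F\<close> the value of the kernel part \<open>f\<close>, and \<open>K\<close> the commutator, \<open>f\<close> maps the pair of generators to
its conjugate by \<open>F\<^sup>-\<^sup>1\<close> and the square of the twist maps it to its conjugate by \<open>K\<close>. As these two
operations commute with each other and with conjugation, \<open>F\<^sup>-\<^sup>1\<close> and \<open>K\<close> commute up to an element of the
centre, which is trivial.\<close>

lemma kernel_part_of_centralizer: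
  assumes w: "w \<in> braid_words 4" and comm: "braid_eq 4 (w @ half_twist_sq) (half_twist_sq @ w)"
  shows "comm_power (foldr push (kernel_part w) [])"
proof -
  let ?N = "foldr nielsen :: braid_word \<Rightarrow> free2 \<times> free2 \<Rightarrow> _"
  let ?x = half_twist_sq
  define f where "f = kernel_word (kernel_part w)"
  define F where "F = word_value (kernel_part w)"
  define v where "v = (letter (False, True), letter (True, True))"
  define K where "K = word_value comm_word"
  \<comment> \<open>The other factor of \<open>w\<close> commutes with the twist and is surjective, so it can be cancelled.\<close>
  have fx: "?N f (?N ?x u) = ?N ?x (?N f u)" for u
  proof -
    have "fst ` set (three_part w) \<subseteq> {1,2,3}" using three_part_letters[OF w] by auto
    from nielsen.surj_word[OF this] obtain u' where u': "?N (three_part w) u' = u" by blast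
    have "?N f (?N ?x u) = ?N w (?N ?x u')"
      by (simp add: nielsen.split_word[OF w] f_def u'[symmetric]
          foldr_nielsen_half_twist_commute[OF three_part_letters[OF w]])
    also have "\<dots> = ?N ?x (?N w u')"
      using fun_cong[OF nielsen.braid_eq_imp_eq[OF comm], of u'] by simp
    also have "\<dots> = ?N ?x (?N f u)"
      by (simp add: nielsen.split_word[OF w] f_def u')
    finally show ?thesis .
  qed
  have K: "K = letter (False, True) - letter (True, True) - letter (False, True) + letter (True, True)"
    using letter_flip[of "(False, True)"] letter_flip[of "(True, True)"]
    by (simp add: K_def comm_word_def word_value_def flip_def diff_conv_add_uminus add.assoc
        del: add_uminus_conv_diff)
  have fv: "?N f v = conj_pair (- F) v"
    by (simp add: f_def v_def F_def nielsen_kernel_word)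
  have xxv: "?N ?x (?N ?x v) = conj_pair K v"
    by (simp add: v_def nielsen_half_twist_sq_twice K)
  have "conj_pair (K + - F) v = conj_pair K (?N f v)"
    by (simp add: fv conj_pair_add)
  also have "\<dots> = ?N f (?N ?x (?N ?x v))"
    by (simp add: xxv foldr_nielsen_conj)
  also have "\<dots> = ?N ?x (?N ?x (?N f v))"
    by (simp add: fx)
  also have "\<dots> = conj_pair (- F + K) v"
    by (simp add: fv foldr_nielsen_conj xxv conj_pair_add)
  finally have eq: "conj_pair (- (- F + K)) (conj_pair (K + - F) v) = conj_pair (- (- F + K)) (conj_pair (- F + K) v)"
    by simp
  define z where "z = - (- F + K) + (K + - F)"
  have "conj_pair z v = v"
    using eq by (simp add: conj_pair_add z_def) (simp add: conj_pair_def)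
  then have "letter (i, True) + z = z + letter (i, True)" for i
    by (cases i) (auto simp: conj_pair_def v_def diff_eq_eq)
  then have "z = 0" by (rule center_free2)
  then have "K + - F = - F + K"
    by (simp add: z_def neg_eq_iff_add_eq_0[symmetric] del: minus_add minus_add_distrib)
  then have "F + (K + - F) + F = F + (- F + K) + F" by simp
  then have "F + K = K + F" by (simp add: add.assoc)
  then have "Rep_free2 (F + K) = Rep_free2 (K + F)" by simp
  moreover have "Rep_free2 K = comm_word"
    unfolding K_def Rep_word_value by (simp add: comm_word_def push_def flip_def)
  ultimately have "foldr push (Rep_free2 F) comm_word = foldr push comm_word (Rep_free2 F)"
    by (simp add: plus_free2.rep_eq)
  then have "comm_power (Rep_free2 F)"
    by (rule centralizer_commutator[OF reduced_Rep])
  then show ?thesis by (simp add: F_def Rep_word_value)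
qed

section \<open>The reduced Burau action\<close>

lemma tpow_mult: "tpow a * tpow b = tpow (a + b)"
  by (simp add: tpow_def Poly_Mapping.mult_single)

lemma tpow_0: "tpow 0 = 1"
  by (simp add: tpow_def single_one)

text \<open>The columns of coordinates are taken with respect to the basis \<open>w\<^sub>1, w\<^sub>2, w\<^sub>3\<close>.\<close>

fun burau_step :: "nat \<times> bool \<Rightarrow> laurent \<times> laurent \<times> laurent \<Rightarrow> laurent \<times> laurent \<times> laurent" where
  "burau_step (i, e) (x, y, z) =
    (let t = tpow 1; s = tpow (- 1) in
     if i = 1 then (if e then (- t * x + y, y, z) else (s * (y - x), y, z))
     else if i = 2 then (if e then (x, t * x - t * y + z, z) else (x, x + s * (z - y), z))
     else (if e then (x, y, t * y - t * z) else (x, y, y - s * z)))"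

lemma t_cancel:
  "tpow 1 * tpow (- 1) = 1" "tpow (- 1) * tpow 1 = 1"
  "tpow 1 * (tpow (- 1) * x) = x" "tpow (- 1) * (tpow 1 * x) = x"
  by (simp_all add: tpow_mult tpow_0 flip: mult.assoc)

interpretation burau: split_braid_action burau_step
proof (unfold_locales, goal_cases)
  case (1 i b v)
  then show ?case by (cases v; cases b) (auto simp: algebra_simps t_cancel Let_def)
next
  case (2 v)
  then show ?case by (cases v) (simp add: algebra_simps t_cancel Let_def)
next
  case (3 v)
  then show ?case by (cases v) (simp add: algebra_simps t_cancel Let_def)
next
  case (4 v)
  then show ?case by (cases v) (simp add: algebra_simps t_cancel Let_def)
next
  case (5 i s l v)
  obtain p q r where v: "v = (p, q, r)" by (cases v)
  obtain g e where l: "l = (g, e)" by (cases l)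
  from 5 show ?case
    by (cases s; cases g; cases e; elim insertE)
      (simp_all add: v l kernel_word_def kernel_letter_def flip_def Let_def algebra_simps t_cancel)
qed

text \<open>The commutator multiplies \<open>w\<^sub>2\<close> and \<open>w\<^sub>3\<close> by \<open>t\<^sup>-\<^sup>2\<close>: the full twist on four strands is \<open>t\<^sup>4\<close>, and the square of
the one on three strands is \<open>t\<^sup>6\<close>.\<close>

lemma burau_comm_power:
  assumes "comm_power u"
  shows "\<exists>k. \<forall>p q. foldr burau_step (kernel_word u) (0, p, q) = (0, k * p, k * q)"
  using assms
proof induction
  case 1
  then show ?case by (intro exI[of _ 1]) (simp add: kernel_word_def)
next
  case (2 w)
  have comm: "foldr burau_step (kernel_word comm_word) (0, p, q) = (0, tpow (- 1) * (tpow (- 1) * p), tpow (- 1) * (tpow (- 1) * q))" for p q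
    by (simp add: comm_word_def kernel_word_def kernel_letter_def Let_def algebra_simps t_cancel)
  from 2 obtain k where "\<And>p q. foldr burau_step (kernel_word w) (0, p, q) = (0, k * p, k * q)" by blast
  then show ?case
    by (intro exI[of _ "tpow (- 1) * (tpow (- 1) * k)"]) (simp add: burau.kernel_word_foldr_push comm mult.assoc)
next
  case (3 w)
  have comm: "foldr burau_step (kernel_word (rev (map flip comm_word))) (0, p, q) = (0, tpow 1 * (tpow 1 * p), tpow 1 * (tpow 1 * q))" for p q
    by (simp add: comm_word_def kernel_word_def kernel_letter_def flip_def Let_def algebra_simps t_cancel)
  from 3 obtain k where "\<And>p q. foldr burau_step (kernel_word w) (0, p, q) = (0, k * p, k * q)" by blast
  then show ?case
    by (intro exI[of _ "tpow 1 * (tpow 1 * k)"]) (simp add: burau.kernel_word_foldr_push comm mult.assoc)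
qed

lemma burau_centralizer:
  assumes w: "w \<in> braid_words 4" and comm: "braid_eq 4 (w @ half_twist_sq) (half_twist_sq @ w)"
  obtains k p q where "foldr burau_step w (0, 1, 0) = (0, k * p, k * q)"
    and "foldr burau_step (three_part w) (0, 1, 0) = (0, p, q)"
proof -
  obtain k where k: "\<And>p q. foldr burau_step (kernel_word (foldr push (kernel_part w) [])) (0, p, q) = (0, k * p, k * q)"
    using burau_comm_power[OF kernel_part_of_centralizer[OF assms]] by blast
  have zero: "fst (foldr burau_step c (0, 1, 0)) = 0" if "fst ` set c \<subseteq> {2,3}" for c
    using that
  proof (induction c)
    case (Cons l c)
    then show ?case
      by (cases l; cases "foldr burau_step c (0, 1, 0)") (auto simp: Let_def)
  qed simp
  obtain p q where pq: "foldr burau_step (three_part w) (0, 1, 0) = (0, p, q)"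
    using zero[OF three_part_letters[OF w]] by (cases "foldr burau_step (three_part w) (0, 1, 0)") auto
  have "foldr burau_step w (0, 1, 0) = (0, k * p, k * q)"
    using k[of p q] by (simp add: burau.split_word[OF w] pq burau.kernel_word_foldr_push kernel_word_def[of "[]"])
  with pq show ?thesis using that by blast
qed

section \<open>Ping-pong for the braid group on three strands\<close>

text \<open>At \<open>t = 3\<close>, the last two rules apply \<open>\<sigma>\<^sub>3\<close> and \<open>\<sigma>\<^sub>2\<^sup>-\<^sup>1\<close> to a vector \<open>p w\<^sub>2 + q w\<^sub>3\<close>. Up to scalars, these are the
products of \<open>D = \<sigma>\<^sub>2 \<sigma>\<^sub>3 \<sigma>\<^sub>2\<close> with \<open>U\<^sup>-\<^sup>1\<close> and \<open>U\<close>, where \<open>U = \<sigma>\<^sub>2 \<sigma>\<^sub>3\<close>. As \<open>D\<close> has order 2 and \<open>U\<close> order 3 up to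
scalars, every element of the group they generate is a power of \<open>U\<close>, times a word in \<open>\<sigma>\<^sub>3\<close> and \<open>\<sigma>\<^sub>2\<^sup>-\<^sup>1\<close>, times
a power of \<open>D\<close>; and \<open>D\<close> exchanges the two axes, on which the induction starts.\<close>

inductive pong :: "real \<times> real \<Rightarrow> bool" where
  "c \<noteq> 0 \<Longrightarrow> pong (c, 0)"
| "c \<noteq> 0 \<Longrightarrow> pong (0, c)"
| "pong (p, q) \<Longrightarrow> pong (p, 3 * p - 3 * q)"
| "pong (p, q) \<Longrightarrow> pong ((q - p) / 3, q)"

text \<open>The number 3 is large enough for both maps to send the axis \<open>q = 0\<close> and the cone \<open>2 \<bar>p\<bar> \<le> \<bar>q\<bar>\<close> into their
union.\<close>

lemma pong_cone: "pong (p, q) \<Longrightarrow> (p, q) \<noteq> (0, 0) \<and> (q = 0 \<or> 2 * \<bar>p\<bar> \<le> \<bar>q\<bar>)"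
proof (induction "(p, q)" arbitrary: p q rule: pong.induct)
  case (4 p q)
  then have "q = 0 \<or> 2 * \<bar>q - p\<bar> \<le> 3 * \<bar>q\<bar>" by (auto simp: abs_if split: if_splits)
  with 4 show ?case by auto
qed auto

lemma pong_scale: "pong (p, q) \<Longrightarrow> c \<noteq> 0 \<Longrightarrow> pong (c * p, c * q)"
proof (induction "(p, q)" arbitrary: p q rule: pong.induct)
  case (3 p q)
  then show ?case using pong.intros(3)[of "c * p" "c * q"] by (simp add: algebra_simps)
next
  case (4 p q)
  then show ?case using pong.intros(4)[of "c * p" "c * q"] by (simp add: algebra_simps)
qed (auto intro: pong.intros)

text \<open>The action of \<open>\<sigma>\<^sub>2 \<sigma>\<^sub>3\<close> at \<open>t = 3\<close>, divided by 3.\<close>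

fun turn :: "real \<times> real \<Rightarrow> real \<times> real" where
  "turn (p, q) = (- q, p - q)"

definition reach :: "real \<times> real \<Rightarrow> bool" where
  "reach v \<longleftrightarrow> pong v \<or> pong (turn v) \<or> pong (turn (turn v))"

lemma pong_minus: "pong (- p, - q) \<longleftrightarrow> pong (p, q)"
  using pong_scale[of p q "- 1"] pong_scale[of "- p" "- q" "- 1"] by auto

lemma turn3: "turn (turn (turn v)) = v"
  by (cases v) simp

lemma reach_turn: "reach (turn v) \<longleftrightarrow> reach v"
  by (auto simp: reach_def turn3)

lemma reach_scale:
  assumes "c \<noteq> 0" shows "reach (c * p, c * q) \<longleftrightarrow> reach (p, q)"
proof -
  have *: "reach (c * p, c * q)" if "reach (p, q)" "c \<noteq> 0" for c p q
    using that pong_scale[of p q c] pong_scale[of "- q" "p - q" c] pong_scale[of "q - p" "- p" c]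
    by (auto simp: reach_def algebra_simps)
  show ?thesis using *[of p q c] *[of "c * p" "c * q" "1 / c"] assms by auto
qed

lemma reach_minus: "reach (- p, - q) \<longleftrightarrow> reach (p, q)"
  using reach_scale[of "- 1" p q] by simp

text \<open>Invariance under \<open>\<sigma>\<^sub>2 \<sigma>\<^sub>3 \<sigma>\<^sub>2\<close>, which is \<open>- 3\<close> times the map \<open>(p, q) \<mapsto> (q, 3 p)\<close>. Applied to a vector of
\<open>pong\<close> it undoes the last step, up to a turn; after a nontrivial turn it makes a new step.\<close>

lemma reach_half_turn:
  assumes "reach (p, q)" shows "reach (q, 3 * p)"
proof -
  consider "pong (p, q)" | "pong (- q, p - q)" | "pong (q - p, - p)"
    using assms by (auto simp: reach_def)
  then show ?thesis
  proof cases
    case 1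
    then show ?thesis
    proof cases
      case (3 q')
      then have "turn (q, 3 * p) = (- 3 * p, - 3 * q')" by simp
      then have "pong (turn (q, 3 * p))"
        using pong_scale[of p q' "- 3"] 3 by simp
      then show ?thesis by (simp add: reach_def)
    next
      case (4 p')
      then have "turn (turn (q, 3 * p)) = (- p', - q)" by (simp add: field_simps)
      then have "pong (turn (turn (q, 3 * p)))"
        using pong_minus[of p' q] 4 by (simp only:)
      then show ?thesis by (simp add: reach_def)
    qed (auto simp: reach_def intro: pong.intros)
  next
    case 2
    from pong.intros(3)[OF 2] have "pong (- q, - (3 * p))" by (simp add: algebra_simps)
    then show ?thesis by (simp add: reach_def pong_minus)
  next
    case 3
    from pong_scale[OF pong.intros(4)[OF 3], of "- 3"] show ?thesis
      by (simp add: reach_def)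
  qed
qed

text \<open>The four letters are products of the turn and the half turn, up to a scalar.\<close>

lemma reach_step:
  assumes "reach (p, q)"
  shows "reach (- 3 * p + q, q)" "reach ((q - p) / 3, q)" "reach (p, 3 * p - 3 * q)" "reach (p, p - q / 3)"
proof -
  have t: "reach (p, q) \<longleftrightarrow> reach (- q, p - q)" "reach (p, q) \<longleftrightarrow> reach (q - p, - p)" for p q
    using reach_turn[of "(p, q)"] reach_turn[of "turn (p, q)"] by simp_all
  have h: "reach (q, 3 * p)" if "reach (p, q)" for p q
    using reach_half_turn that by blast
  show "reach (p, 3 * p - 3 * q)"
    using h[of "q - p" "- p"] assms t(2)[of p q] reach_minus[of p "3 * p - 3 * q"] by simp
  have e: "- 3 * ((q - p) / 3) = p - q" by (simp add: field_simps)
  show "reach ((q - p) / 3, q)"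
    using h[of "- q" "p - q"] assms t(1)[of p q] reach_scale[of "- 3" "(q - p) / 3" q, unfolded e] by simp
  show "reach (- 3 * p + q, q)"
    using h[OF assms] t(2)[of q "3 * p"] reach_minus[of "- 3 * p + q" q] by simp
  show "reach (p, p - q / 3)"
    using h[OF assms] t(1)[of q "3 * p"] reach_scale[of "- 3" p "p - q / 3"] by (simp add: algebra_simps)
qed

section \<open>Evaluation homomorphisms\<close>

text \<open>If \<open>f\<close> is multiplicative, this is the ring homomorphism with \<open>t\<^sup>k \<mapsto> f k\<close>. The substitution \<open>t \<mapsto> t\<^sup>-\<^sup>1\<close> and the
evaluations at 1 and at 3 are of this form.\<close>

definition laurent_eval :: "(int \<Rightarrow> 'a::comm_ring_1) \<Rightarrow> laurent \<Rightarrow> 'a" where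
  "laurent_eval f p = (\<Sum>k\<in>Poly_Mapping.keys p. of_int (Poly_Mapping.lookup p k) * f k)"

lemma laurent_eval_superset:
  assumes "finite A" "Poly_Mapping.keys p \<subseteq> A"
  shows "laurent_eval f p = (\<Sum>k\<in>A. of_int (Poly_Mapping.lookup p k) * f k)"
  unfolding laurent_eval_def using assms by (intro sum.mono_neutral_left) (auto simp: in_keys_iff)

lemma laurent_eval_add: "laurent_eval f (p + q) = laurent_eval f p + laurent_eval f q"
proof -
  let ?A = "Poly_Mapping.keys p \<union> Poly_Mapping.keys q"
  have "Poly_Mapping.keys (p + q) \<subseteq> ?A" by (rule keys_add)
  then show ?thesis
    by (simp add: laurent_eval_superset[of ?A] lookup_add distrib_right sum.distrib)
qed

lemma laurent_eval_0 [simp]: "laurent_eval f 0 = 0"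
  by (simp add: laurent_eval_def)

lemma laurent_eval_uminus: "laurent_eval f (- p) = - laurent_eval f p"
  using laurent_eval_add[of f p "- p"] by (simp add: eq_neg_iff_add_eq_0 add.commute)

lemma laurent_eval_diff: "laurent_eval f (p - q) = laurent_eval f p - laurent_eval f q"
  using laurent_eval_add[of f p "- q"] by (simp add: laurent_eval_uminus)

lemma laurent_eval_sum: "laurent_eval f (sum g A) = (\<Sum>x\<in>A. laurent_eval f (g x))"
  by (induction A rule: infinite_finite_induct) (simp_all add: laurent_eval_add)

lemma laurent_eval_single: "laurent_eval f (Poly_Mapping.single k c) = of_int c * f k"
  by (simp add: laurent_eval_def)

lemma laurent_eval_mult:
  assumes f: "\<And>j k. f (j + k) = f j * f k"
  shows "laurent_eval f (p * q) = laurent_eval f p * laurent_eval f q"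
proof -
  have 1: "laurent_eval f (Poly_Mapping.single k c * Poly_Mapping.single j d)
      = laurent_eval f (Poly_Mapping.single k c) * laurent_eval f (Poly_Mapping.single j d)" for k j c d
    by (simp add: mult_single laurent_eval_single f)
  have s: "p = (\<Sum>k\<in>Poly_Mapping.keys p. Poly_Mapping.single k (Poly_Mapping.lookup p k))" for p :: laurent
    by (rule poly_mapping_eqI) (simp add: lookup_sum lookup_single when_def in_keys_iff)
  have "laurent_eval f ((\<Sum>k\<in>A. Poly_Mapping.single k (c k)) * (\<Sum>k\<in>B. Poly_Mapping.single k (d k)))
      = laurent_eval f (\<Sum>k\<in>A. Poly_Mapping.single k (c k)) * laurent_eval f (\<Sum>k\<in>B. Poly_Mapping.single k (d k))"
    for A B :: "int set" and c d
    by (simp add: sum_product laurent_eval_sum 1)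
  from this[where A = "Poly_Mapping.keys p" and B = "Poly_Mapping.keys q"
      and c = "Poly_Mapping.lookup p" and d = "Poly_Mapping.lookup q"]
  show ?thesis by (simp only: s[symmetric])
qed

locale laurent_hom =
  fixes f :: "int \<Rightarrow> 'a::comm_ring_1"
  assumes mult: "f (j + k) = f j * f k" and zero: "f 0 = 1"
begin

lemma eval_tpow [simp]: "laurent_eval f (tpow k) = f k"
  by (simp add: tpow_def laurent_eval_single)

lemma eval_1 [simp]: "laurent_eval f 1 = 1"
  using eval_tpow[of 0] by (simp add: tpow_0 zero)

lemma eval_mult [simp]: "laurent_eval f (p * q) = laurent_eval f p * laurent_eval f q"
  by (rule laurent_eval_mult) (rule mult)

lemmas eval_add [simp] = laurent_eval_add[of f] and eval_uminus [simp] = laurent_eval_uminus[of f]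
  and eval_diff [simp] = laurent_eval_diff[of f]

end

lemma laurent_at_1_eval: "laurent_at_1 = laurent_eval (\<lambda>_. 1)"
  by (simp add: fun_eq_iff laurent_at_1_def laurent_eval_def)

interpretation at_1: laurent_hom "\<lambda>_. 1 :: int"
  by unfold_locales simp_all

lemma laurent_bar_eval: "laurent_bar = laurent_eval (\<lambda>k. tpow (- k))"
proof
  fix p :: laurent
  have c: "of_int c * tpow k = Poly_Mapping.single k c" for c k
  proof -
    have "(of_int c :: laurent) = Poly_Mapping.single 0 c"
      by (metis single_of_int of_int_eq_id id_apply)
    then show ?thesis by (simp only: tpow_def mult_single) simp
  qed
  show "laurent_bar p = laurent_eval (\<lambda>k. tpow (- k)) p"
  proof (rule poly_mapping_eqI)
    fix j
    have "Poly_Mapping.lookup (laurent_eval (\<lambda>k. tpow (- k)) p) j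
        = (\<Sum>k\<in>Poly_Mapping.keys p. if k = - j then Poly_Mapping.lookup p k else 0)"
      unfolding laurent_eval_def lookup_sum c lookup_single when_def
      by (intro sum.cong) auto
    also have "\<dots> = Poly_Mapping.lookup p (- j)"
      by (simp add: in_keys_iff)
    also have "\<dots> = Poly_Mapping.lookup (laurent_bar p) j"
      unfolding laurent_bar_def by (subst map_key.rep_eq) (auto simp: inj_def)
    finally show "Poly_Mapping.lookup (laurent_bar p) j = Poly_Mapping.lookup (laurent_eval (\<lambda>k. tpow (- k)) p) j"
      by simp
  qed
qed

interpretation bar: laurent_hom "\<lambda>k. tpow (- k)"
  by unfold_locales (simp_all add: tpow_mult tpow_0)

interpretation at_3: laurent_hom "\<lambda>k. (3::real) powi k"
  by unfold_locales (simp_all add: power_int_add)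

text \<open>The first coordinate is dropped because this is applied to vectors in the span of \<open>w\<^sub>2\<close> and \<open>w\<^sub>3\<close>.\<close>

fun at_3_pair :: "laurent \<times> laurent \<times> laurent \<Rightarrow> real \<times> real" where
  "at_3_pair (x, y, z) = (laurent_eval (\<lambda>k. 3 powi k) y, laurent_eval (\<lambda>k. 3 powi k) z)"

lemma reach_three_word:
  assumes "fst ` set c \<subseteq> {2,3}"
  shows "fst (foldr burau_step c (0, 1, 0)) = 0 \<and> reach (at_3_pair (foldr burau_step c (0, 1, 0)))"
  using assms
proof (induction c)
  case Nil
  show ?case by (simp add: reach_def pong.intros)
next
  case (Cons l c)
  obtain i e where l: "l = (i, e)" by (cases l)
  obtain y z where v: "foldr burau_step c (0, 1, 0) = (0, y, z)"
    using Cons by (cases "foldr burau_step c (0, 1, 0)") auto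
  then have r: "reach (laurent_eval (\<lambda>k. 3 powi k) y, laurent_eval (\<lambda>k. 3 powi k) z)" using Cons by simp
  have third: "3 powi - 1 = (1 / 3 :: real)" by (simp add: power_int_minus)
  have "i = 2 \<or> i = 3" using Cons.prems by (auto simp: l)
  then show ?case
    using reach_step[OF r] by (cases e) (auto simp add: l v Let_def third diff_divide_distrib)
qed

section \<open>Reflections\<close>

text \<open>The map \<open>u \<mapsto> u + (y u) x\<close> for a column \<open>x\<close> and a row \<open>y\<close>. It is a reflection with eigenvalue \<open>- t\<close> when
\<open>y x = - (1 + t)\<close>.\<close>

definition refl_mat :: "nat \<Rightarrow> (nat \<Rightarrow> laurent) \<Rightarrow> (nat \<Rightarrow> laurent) \<Rightarrow> laurent mat" where
  "refl_mat n x y = mat n n (\<lambda>(i, j). (if i = j then 1 else 0) + x i * y j)"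

lemma refl_mat_carrier [simp]: "refl_mat n x y \<in> carrier_mat n n"
  "dim_row (refl_mat n x y) = n" "dim_col (refl_mat n x y) = n"
  by (simp_all add: refl_mat_def)

lemma refl_mat_index [simp]:
  "i < n \<Longrightarrow> j < n \<Longrightarrow> refl_mat n x y $$ (i, j) = (if i = j then 1 else 0) + x i * y j"
  by (simp add: refl_mat_def)

lemma transpose_refl_mat: "transpose_mat (refl_mat n x y) = refl_mat n y x"
  by (rule eq_matI) (auto simp: mult.commute)

lemma refl_mat_times:
  assumes "M \<in> carrier_mat n m" "i < n" "j < m"
  shows "(refl_mat n x y * M) $$ (i, j) = M $$ (i, j) + x i * (\<Sum>k<n. y k * M $$ (k, j))"
proof -
  have "(refl_mat n x y * M) $$ (i, j) = (\<Sum>k<n. ((if i = k then 1 else 0) + x i * y k) * M $$ (k, j))"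
    using assms by (auto simp: scalar_prod_def atLeast0LessThan intro!: sum.cong)
  also have "\<dots> = (\<Sum>k<n. (if i = k then M $$ (k, j) else 0) + x i * (y k * M $$ (k, j)))"
    by (intro sum.cong) (auto simp: algebra_simps)
  also have "\<dots> = M $$ (i, j) + x i * (\<Sum>k<n. y k * M $$ (k, j))"
    using assms by (simp add: sum.distrib sum_distrib_left)
  finally show ?thesis .
qed

lemma times_refl_mat:
  assumes "M \<in> carrier_mat m n" "i < m" "j < n"
  shows "(M * refl_mat n x y) $$ (i, j) = M $$ (i, j) + (\<Sum>k<n. M $$ (i, k) * x k) * y j"
proof -
  have "(M * refl_mat n x y) $$ (i, j) = (\<Sum>k<n. M $$ (i, k) * ((if k = j then 1 else 0) + x k * y j))"
    using assms by (auto simp: scalar_prod_def atLeast0LessThan intro!: sum.cong)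
  also have "\<dots> = (\<Sum>k<n. (if k = j then M $$ (i, k) else 0) + M $$ (i, k) * x k * y j)"
    by (intro sum.cong) (auto simp: algebra_simps)
  also have "\<dots> = M $$ (i, j) + (\<Sum>k<n. M $$ (i, k) * x k) * y j"
    using assms by (simp add: sum.distrib sum_distrib_right)
  finally show ?thesis .
qed

lemma refl_mat_vec:
  assumes "v \<in> carrier_vec n"
  shows "refl_mat n x y *\<^sub>v v = v + (\<Sum>k<n. y k * v $ k) \<cdot>\<^sub>v vec n x"
proof (rule eq_vecI)
  fix i assume i: "i < dim_vec (v + (\<Sum>k<n. y k * v $ k) \<cdot>\<^sub>v vec n x)"
  then have i: "i < n" by simp
  have "(refl_mat n x y *\<^sub>v v) $ i = (\<Sum>k<n. ((if i = k then 1 else 0) + x i * y k) * v $ k)"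
    using assms i by (auto simp: scalar_prod_def atLeast0LessThan intro!: sum.cong)
  also have "\<dots> = (\<Sum>k<n. (if i = k then v $ k else 0) + x i * (y k * v $ k))"
    by (intro sum.cong) (auto simp: algebra_simps)
  also have "\<dots> = v $ i + x i * (\<Sum>k<n. y k * v $ k)"
    using i by (simp add: sum.distrib sum_distrib_left)
  finally show "(refl_mat n x y *\<^sub>v v) $ i = (v + (\<Sum>k<n. y k * v $ k) \<cdot>\<^sub>v vec n x) $ i"
    using i assms by (simp add: mult.commute)
qed (use assms in auto)

lemma GL_simps:
  "carrier (GL n) = {A \<in> carrier_mat n n. \<exists>B\<in>carrier_mat n n. B * A = 1\<^sub>m n \<and> A * B = 1\<^sub>m n}"
  "A \<otimes>\<^bsub>GL n\<^esub> B = A * B" "\<one>\<^bsub>GL n\<^esub> = 1\<^sub>m n"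
  by (auto simp: GL_def units_of_def Units_def ring_mat_simps)

lemma group_GL: "group (GL n)"
proof -
  interpret ring "ring_mat TYPE(laurent) n ()" by (rule ring_mat)
  show ?thesis unfolding GL_def by (rule units_group)
qed

lemma refl_mat_inverse:
  assumes yx: "(\<Sum>k<n. y k * x k) = - (1 + tpow 1)"
  shows "refl_mat n x y * refl_mat n (\<lambda>i. tpow (- 1) * x i) y = 1\<^sub>m n"
    and "refl_mat n (\<lambda>i. tpow (- 1) * x i) y * refl_mat n x y = 1\<^sub>m n"
proof -
  have *: "(\<Sum>k<n. ((if i = k then 1 else 0) + f i * y k) * h k) = h i + f i * (\<Sum>k<n. y k * h k)"
    if "i < n" for i f h
  proof -
    have "(\<Sum>k<n. ((if i = k then 1 else 0) + f i * y k) * h k)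
        = (\<Sum>k<n. (if i = k then h k else 0) + f i * (y k * h k))"
      by (intro sum.cong) (auto simp: algebra_simps)
    then show ?thesis using that by (simp add: sum.distrib sum_distrib_left)
  qed
  have yx': "(\<Sum>k<n. y k * (tpow (- 1) * x k)) = - (1 + tpow (- 1))"
  proof -
    have "(\<Sum>k<n. y k * (tpow (- 1) * x k)) = tpow (- 1) * (\<Sum>k<n. y k * x k)"
      by (simp add: sum_distrib_left mult.left_commute)
    moreover have "tpow (- 1) * - (1 + tpow 1) = - (1 + tpow (- 1))"
      by (simp add: algebra_simps t_cancel)
    ultimately show ?thesis by (simp only: yx)
  qed
  show "refl_mat n x y * refl_mat n (\<lambda>i. tpow (- 1) * x i) y = 1\<^sub>m n"
  proof (rule eq_matI)
    fix i j assume "i < dim_row (1\<^sub>m n :: laurent mat)" "j < dim_col (1\<^sub>m n :: laurent mat)"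
    then have ij: "i < n" "j < n" by auto
    have "(refl_mat n x y * refl_mat n (\<lambda>i. tpow (- 1) * x i) y) $$ (i, j)
        = refl_mat n x y $$ (i, j) + (\<Sum>k<n. refl_mat n x y $$ (i, k) * (tpow (- 1) * x k)) * y j"
      by (rule times_refl_mat) (use ij in auto)
    also have "(\<Sum>k<n. refl_mat n x y $$ (i, k) * (tpow (- 1) * x k)) = - x i"
    proof -
      have "(\<Sum>k<n. refl_mat n x y $$ (i, k) * (tpow (- 1) * x k))
          = tpow (- 1) * x i + x i * (\<Sum>k<n. y k * (tpow (- 1) * x k))"
        using ij *[of i x "\<lambda>k. tpow (- 1) * x k"] by simp
      then show ?thesis unfolding yx' by (simp add: algebra_simps)
    qed
    finally show "(refl_mat n x y * refl_mat n (\<lambda>i. tpow (- 1) * x i) y) $$ (i, j) = 1\<^sub>m n $$ (i, j)"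
      using ij by simp
  qed auto
  show "refl_mat n (\<lambda>i. tpow (- 1) * x i) y * refl_mat n x y = 1\<^sub>m n"
  proof (rule eq_matI)
    fix i j assume "i < dim_row (1\<^sub>m n :: laurent mat)" "j < dim_col (1\<^sub>m n :: laurent mat)"
    then have ij: "i < n" "j < n" by auto
    have "(refl_mat n (\<lambda>i. tpow (- 1) * x i) y * refl_mat n x y) $$ (i, j)
        = refl_mat n (\<lambda>i. tpow (- 1) * x i) y $$ (i, j) + (\<Sum>k<n. refl_mat n (\<lambda>i. tpow (- 1) * x i) y $$ (i, k) * x k) * y j"
      by (rule times_refl_mat) (use ij in auto)
    also have "(\<Sum>k<n. refl_mat n (\<lambda>i. tpow (- 1) * x i) y $$ (i, k) * x k) = - (tpow (- 1) * x i)"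
    proof -
      have "(\<Sum>k<n. refl_mat n (\<lambda>i. tpow (- 1) * x i) y $$ (i, k) * x k)
          = x i + tpow (- 1) * x i * (\<Sum>k<n. y k * x k)"
        using ij *[of i "\<lambda>i. tpow (- 1) * x i" x] by simp
      then show ?thesis unfolding yx by (simp add: algebra_simps t_cancel)
    qed
    finally show "(refl_mat n (\<lambda>i. tpow (- 1) * x i) y * refl_mat n x y) $$ (i, j) = 1\<^sub>m n $$ (i, j)"
      using ij by simp
  qed auto
qed

lemma refl_mat_GL:
  assumes "(\<Sum>k<n. y k * x k) = - (1 + tpow 1)"
  shows "refl_mat n x y \<in> carrier (GL n)"
  using refl_mat_inverse[OF assms] by (auto simp: GL_simps intro!: bexI[of _ "refl_mat n (\<lambda>i. tpow (- 1) * x i) y"])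

text \<open>A reflection is unitary when \<open>J\<close> maps its row \<open>y\<close> to \<open>- (1 + t)\<close> times the conjugate of its column \<open>x\<close>;
the conditions \<open>Jy\<close> and \<open>yJ\<close> are this and its conjugate transpose. The rank one corrections of
\<open>J_mat\<close> then add up to a multiple of
\<open>(1 + t) (1 + t\<^sup>-\<^sup>1) - (1 + t) - (1 + t\<^sup>-\<^sup>1) = 0\<close>.\<close>

lemma refl_mat_Gamma:
  assumes yx: "(\<Sum>k<n. y k * x k) = - (1 + tpow 1)"
    and vx: "(\<Sum>k<n. tpow (int (Suc k)) * x k) = 0"
    and y1: "(\<Sum>k<n. y k) = 0"
    and Jy: "\<And>i. i < n \<Longrightarrow> (\<Sum>k<n. J_mat n $$ (i, k) * y k) = - (1 + tpow 1) * laurent_bar (x i)"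
    and yJ: "\<And>j. j < n \<Longrightarrow> (\<Sum>k<n. laurent_bar (y k) * J_mat n $$ (k, j)) = - (1 + tpow (- 1)) * x j"
    and perm: "map_mat laurent_at_1 (refl_mat n x y) \<in> permutation_matrices n"
  shows "refl_mat n x y \<in> carrier (Gamma n)"
proof -
  let ?A = "refl_mat n x y" and ?x = "\<lambda>i. laurent_bar (x i)" and ?y = "\<lambda>i. laurent_bar (y i)"
  have J: "J_mat n \<in> carrier_mat n n" and v: "v_row n \<in> carrier_mat 1 n" and o: "ones_col n \<in> carrier_mat n 1"
    by (simp_all add: J_mat_def v_row_def ones_col_def mat1_def)
  have 1: "v_row n * ?A = v_row n"
  proof (rule eq_matI)
    fix i j assume "i < dim_row (v_row n)" "j < dim_col (v_row n)"
    then have ij: "i < 1" "j < n" using v by auto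
    show "(v_row n * ?A) $$ (i, j) = v_row n $$ (i, j)"
      using times_refl_mat[OF v ij] vx ij by (simp add: v_row_def mat1_def)
  qed (use v in auto)
  have 2: "?A * ones_col n = ones_col n"
  proof (rule eq_matI)
    fix i j assume "i < dim_row (ones_col n)" "j < dim_col (ones_col n)"
    then have ij: "i < n" "j < 1" using o by auto
    show "(?A * ones_col n) $$ (i, j) = ones_col n $$ (i, j)"
      using refl_mat_times[OF o ij] y1 ij by (simp add: ones_col_def mat1_def)
  qed (use o in auto)
  have bar: "map_mat laurent_bar ?A = refl_mat n ?x ?y"
    by (rule eq_matI) (auto simp: laurent_bar_eval)
  have RJ: "refl_mat n ?x ?y * J_mat n \<in> carrier_mat n n"
    using J by (auto intro: mult_carrier_mat)
  have 3: "refl_mat n ?x ?y * J_mat n * refl_mat n y x = J_mat n"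
  proof (rule eq_matI)
    fix i j assume "i < dim_row (J_mat n)" "j < dim_col (J_mat n)"
    then have ij: "i < n" "j < n" using J by auto
    have M: "(refl_mat n ?x ?y * J_mat n) $$ (i, k) = J_mat n $$ (i, k) - (1 + tpow (- 1)) * ?x i * x k" if "k < n" for k
      using refl_mat_times[OF J ij(1) that, of ?x ?y] yJ[OF that] by (simp add: algebra_simps)
    have "(\<Sum>k<n. (refl_mat n ?x ?y * J_mat n) $$ (i, k) * y k)
        = (\<Sum>k<n. J_mat n $$ (i, k) * y k - (1 + tpow (- 1)) * ?x i * (y k * x k))"
      by (intro sum.cong) (auto simp: M algebra_simps)
    also have "\<dots> = - (1 + tpow 1) * ?x i - (1 + tpow (- 1)) * ?x i * (- (1 + tpow 1))"
      by (simp only: sum_subtractf Jy[OF ij(1)] sum_distrib_left[symmetric] yx)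
    also have "\<dots> = (1 + tpow (- 1)) * ?x i"
      by (simp add: algebra_simps t_cancel)
    finally show "(refl_mat n ?x ?y * J_mat n * refl_mat n y x) $$ (i, j) = J_mat n $$ (i, j)"
      using times_refl_mat[OF RJ ij, of y x] M[OF ij(2)] by simp
  qed (use J in auto)
  have "?A \<in> carrier (GL n)" by (rule refl_mat_GL[OF yx])
  with 1 2 3 perm show ?thesis
    by (simp add: Gamma_def bar transpose_refl_mat)
qed

section \<open>Roots of the Burau module\<close>

text \<open>The column \<open>a w\<^sub>1 + b w\<^sub>2 + c w\<^sub>3\<close>.\<close>

fun root_col :: "laurent \<times> laurent \<times> laurent \<Rightarrow> nat \<Rightarrow> laurent" where
  "root_col (a, b, c) i =
    (if i = 0 then a else if i = 1 then tpow (- 1) * (b - a)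
     else if i = 2 then tpow (- 2) * (c - b) else - tpow (- 3) * c)"

text \<open>The row that makes the reflection in \<open>root_col\<close> unitary: \<open>J y = - (1 + t)\<close> times the conjugate of
\<open>root_col\<close>.\<close>

fun root_row :: "laurent \<times> laurent \<times> laurent \<Rightarrow> nat \<Rightarrow> laurent" where
  "root_row (a, b, c) i =
    (let a = laurent_bar a; b = laurent_bar b; c = laurent_bar c in
     if i = 0 then - tpow 1 * a else if i = 1 then tpow 1 * a - tpow 2 * b
     else if i = 2 then tpow 2 * b - tpow 3 * c else tpow 3 * c)"

fun coord :: "laurent \<times> laurent \<times> laurent \<Rightarrow> nat \<Rightarrow> laurent" where
  "coord (a, b, c) i = (if i = 0 then a else if i = 1 then b else c)"

text \<open>The row \<open>root_row\<close> in coordinates of the Burau module, that is, multiplied by \<open>W_mat 4\<close>.\<close>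

fun red_row :: "laurent \<times> laurent \<times> laurent \<Rightarrow> nat \<Rightarrow> laurent" where
  "red_row (a, b, c) i =
    (let a = laurent_bar a; b = laurent_bar b; c = laurent_bar c in
     if i = 0 then tpow 1 * b - (1 + tpow 1) * a
     else if i = 1 then a - (1 + tpow 1) * b + tpow 1 * c
     else b - (1 + tpow 1) * c)"

text \<open>The condition that \<open>root_row\<close> times \<open>root_col\<close> is \<open>- (1 + t)\<close>. It says that the vector has the norm of
\<open>w\<^sub>1\<close>, \<open>w\<^sub>2\<close> and \<open>w\<^sub>3\<close>.\<close>

fun is_root :: "laurent \<times> laurent \<times> laurent \<Rightarrow> bool" where
  "is_root (a, b, c) \<longleftrightarrow>
    (1 + tpow 1) * (a * laurent_bar a + b * laurent_bar b + c * laurent_bar c) =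
      tpow 1 * (a * laurent_bar b + b * laurent_bar c) + laurent_bar a * b + laurent_bar b * c + (1 + tpow 1)"

lemma sum_lessThan_4: "(\<Sum>k<4::nat. f k) = f 0 + f 1 + f 2 + (f 3 :: 'a::comm_monoid_add)"
  by (simp add: numeral_eq_Suc lessThan_Suc ac_simps)

lemma sum_lessThan_3: "(\<Sum>k<3::nat. f k) = f 0 + f 1 + (f 2 :: 'a::comm_monoid_add)"
  by (simp add: numeral_eq_Suc lessThan_Suc ac_simps)

lemma tpow_mult_left: "tpow a * (tpow b * x) = tpow (a + b) * x"
  by (simp add: tpow_mult flip: mult.assoc)

lemma bar_bar [simp]: "laurent_bar (laurent_bar p) = p"
  unfolding laurent_bar_def
  by (rule poly_mapping_eqI) (simp add: map_key.rep_eq inj_def)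

lemmas bar_simps = bar.eval_add bar.eval_mult bar.eval_diff bar.eval_uminus bar.eval_tpow bar.eval_1

lemma root_row_col: "is_root r \<Longrightarrow> (\<Sum>k<4. root_row r k * root_col r k) = - (1 + tpow 1)"
  by (cases r) (simp add: sum_lessThan_4 Let_def algebra_simps tpow_mult tpow_mult_left tpow_0)

lemma red_row_coord: "is_root r \<Longrightarrow> (\<Sum>k<3. red_row r k * coord r k) = - (1 + tpow 1)"
  by (cases r) (simp add: sum_lessThan_3 Let_def algebra_simps tpow_mult tpow_mult_left tpow_0)

lemma less_4: "(i::nat) < 4 \<longleftrightarrow> i = 0 \<or> i = 1 \<or> i = 2 \<or> i = 3"
  by auto

lemma less_3: "(i::nat) < 3 \<longleftrightarrow> i = 0 \<or> i = 1 \<or> i = 2"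
  by auto

lemma refl_root_Gamma:
  assumes r: "is_root r"
    and perm: "map_mat laurent_at_1 (refl_mat 4 (root_col r) (root_row r)) \<in> permutation_matrices 4"
  shows "refl_mat 4 (root_col r) (root_row r) \<in> carrier (Gamma 4)"
proof (rule refl_mat_Gamma)
  obtain a b c where r': "r = (a, b, c)" by (cases r)
  show "(\<Sum>k<4. root_row r k * root_col r k) = - (1 + tpow 1)"
    by (rule root_row_col[OF r])
  show "(\<Sum>k<4. tpow (int (Suc k)) * root_col r k) = 0"
    by (simp add: r' sum_lessThan_4 algebra_simps tpow_mult tpow_mult_left tpow_0)
  show "(\<Sum>k<4. root_row r k) = 0"
    by (simp add: r' sum_lessThan_4 Let_def)
  show "(\<Sum>k<4. J_mat 4 $$ (i, k) * root_row r k) = - (1 + tpow 1) * laurent_bar (root_col r i)" if "i < 4" for i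
    using that unfolding less_4
    by (elim disjE)
      (simp_all add: r' sum_lessThan_4 Let_def J_mat_def mat1_def algebra_simps tpow_mult tpow_mult_left tpow_0
        laurent_bar_eval bar_simps)
  show "(\<Sum>k<4. laurent_bar (root_row r k) * J_mat 4 $$ (k, j)) = - (1 + tpow (- 1)) * root_col r j" if "j < 4" for j
    using that bar_bar[of a] bar_bar[of b] bar_bar[of c] unfolding less_4
    by (elim disjE)
      (simp_all add: r' sum_lessThan_4 Let_def J_mat_def mat1_def algebra_simps tpow_mult tpow_mult_left tpow_0
        laurent_bar_eval bar_simps)
qed (rule perm)

lemma W_mat_carrier: "W_mat 4 \<in> carrier_mat 4 3"
  by (simp add: W_mat_def mat1_def)

lemma refl_root_W:
  "refl_mat 4 (root_col r) (root_row r) * W_mat 4 = W_mat 4 * refl_mat 3 (coord r) (red_row r)"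
proof (rule eq_matI)
  obtain a b c where r': "r = (a, b, c)" by (cases r)
  fix i j assume "i < dim_row (W_mat 4 * refl_mat 3 (coord r) (red_row r))"
    "j < dim_col (W_mat 4 * refl_mat 3 (coord r) (red_row r))"
  then have ij: "i < 4" "j < 3" using W_mat_carrier by auto
  have 1: "(\<Sum>k<4. root_row r k * W_mat 4 $$ (k, j)) = red_row r j"
    using ij(2) unfolding less_3
    by (elim disjE) (simp_all add: r' sum_lessThan_4 Let_def W_mat_def mat1_def algebra_simps tpow_mult tpow_mult_left tpow_0)
  have 2: "(\<Sum>k<3. W_mat 4 $$ (i, k) * coord r k) = root_col r i"
    using ij(1) unfolding less_4
    by (elim disjE) (simp_all add: r' sum_lessThan_3 W_mat_def mat1_def algebra_simps tpow_mult tpow_mult_left tpow_0)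
  show "(refl_mat 4 (root_col r) (root_row r) * W_mat 4) $$ (i, j)
      = (W_mat 4 * refl_mat 3 (coord r) (red_row r)) $$ (i, j)"
    by (simp only: refl_mat_times[OF W_mat_carrier ij] times_refl_mat[OF W_mat_carrier ij] 1 2)
qed (use W_mat_carrier in auto)

lemma refl_root_Gamma_red:
  assumes r: "is_root r"
    and perm: "map_mat laurent_at_1 (refl_mat 4 (root_col r) (root_row r)) \<in> permutation_matrices 4"
  shows "refl_mat 3 (coord r) (red_row r) \<in> carrier (Gamma_red 4)"
  using refl_root_Gamma[OF assms] refl_root_W[of r] refl_mat_GL[OF red_row_coord[OF r]]
  by (auto simp: Gamma_red_def)

fun unit_root :: "nat \<Rightarrow> laurent \<times> laurent \<times> laurent" where
  "unit_root i = (if i = 1 then 1 else 0, if i = 2 then 1 else 0, if i = 3 then 1 else 0)"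

lemma laurent_bar_0 [simp]: "laurent_bar 0 = 0" and laurent_bar_1 [simp]: "laurent_bar 1 = 1"
  by (simp_all add: laurent_bar_eval)

lemma burau_u_gen_refl:
  assumes "i \<in> {1,2,3}"
  shows "burau_u_gen 4 i = refl_mat 4 (root_col (unit_root i)) (root_row (unit_root i))"
proof (rule eq_matI)
  fix k l assume "k < dim_row (refl_mat 4 (root_col (unit_root i)) (root_row (unit_root i)))"
    "l < dim_col (refl_mat 4 (root_col (unit_root i)) (root_row (unit_root i)))"
  then have "k < 4" "l < 4" by auto
  then show "burau_u_gen 4 i $$ (k, l) = refl_mat 4 (root_col (unit_root i)) (root_row (unit_root i)) $$ (k, l)"
    using assms unfolding less_4
    by (elim disjE insertE)
      (simp_all add: burau_u_gen_def Let_def mat_of_rows_list_def tpow_mult tpow_mult_left tpow_0)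
qed (use assms in \<open>auto simp: burau_u_gen_def dim_diag_block_mat mat_of_rows_list_def\<close>)

lemma burau_r_gen_refl:
  assumes "i \<in> {1,2,3}"
  shows "burau_r_gen 4 i = refl_mat 3 (coord (unit_root i)) (red_row (unit_root i))"
proof (rule eq_matI)
  fix k l assume "k < dim_row (refl_mat 3 (coord (unit_root i)) (red_row (unit_root i)))"
    "l < dim_col (refl_mat 3 (coord (unit_root i)) (red_row (unit_root i)))"
  then have "k < 3" "l < 3" by auto
  then show "burau_r_gen 4 i $$ (k, l) = refl_mat 3 (coord (unit_root i)) (red_row (unit_root i)) $$ (k, l)"
    using assms unfolding less_3
    by (elim disjE insertE) (simp_all add: burau_r_gen_def mat1_def Let_def)
qed (use assms in \<open>auto simp: burau_r_gen_def mat1_def\<close>)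

lemma is_root_unit: "i \<in> {1,2,3} \<Longrightarrow> is_root (unit_root i)"
  by auto

lemma transposition_matrix:
  assumes "a < n" "b < n"
    and M: "M \<in> carrier_mat n n"
    and "\<And>i j. i < n \<Longrightarrow> j < n \<Longrightarrow> M $$ (i, j) = (if i = transpose a b j then 1 else 0)"
  shows "M \<in> permutation_matrices n"
proof -
  have "transpose a b permutes {..<n}"
    using assms by (intro permutes_swap_id) auto
  moreover have "M = mat n n (\<lambda>(r, c). if r = transpose a b c then 1 else 0)"
    using assms by (intro eq_matI) auto
  ultimately show ?thesis unfolding permutation_matrices_def by blast
qed

lemma unit_root_perm:
  assumes i: "i \<in> {1,2,3}"
  shows "map_mat laurent_at_1 (refl_mat 4 (root_col (unit_root i)) (root_row (unit_root i))) \<in> permutation_matrices 4"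
proof (rule transposition_matrix[of "i - 1" _ i])
  fix k l :: nat assume "k < 4" "l < 4"
  then show "map_mat laurent_at_1 (refl_mat 4 (root_col (unit_root i)) (root_row (unit_root i))) $$ (k, l)
      = (if k = transpose (i - 1) i l then 1 else 0)"
    using i unfolding less_4
    by (elim disjE insertE) (simp_all add: laurent_at_1_eval Let_def transpose_def)
qed (use i in auto)

section \<open>The exotic root\<close>

text \<open>Polynomials in \<open>t\<close> are handled by their lists of coefficients, so that the norm equation for the root
becomes an equation between lists of integers.\<close>

abbreviation int_poly :: "int list \<Rightarrow> 'a::comm_ring_1 \<Rightarrow> 'a" where
  "int_poly cs t \<equiv> horner_sum of_int t cs"

lemma (in laurent_hom) eval_of_int [simp]: "laurent_eval f (of_int m) = of_int m"
proof -
  have "laurent_eval f (of_nat k) = of_nat k" for k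
    by (induction k) simp_all
  then show ?thesis by (cases m) (simp_all del: of_nat_Suc)
qed

lemma (in laurent_hom) eval_int_poly: "laurent_eval f (int_poly cs x) = int_poly cs (laurent_eval f x)"
  by (induction cs) simp_all

fun coeff_add :: "int list \<Rightarrow> int list \<Rightarrow> int list" where
  "coeff_add [] ds = ds"
| "coeff_add cs [] = cs"
| "coeff_add (c # cs) (d # ds) = (c + d) # coeff_add cs ds"

fun coeff_mult :: "int list \<Rightarrow> int list \<Rightarrow> int list" where
  "coeff_mult [] ds = []"
| "coeff_mult (c # cs) ds = coeff_add (map ((*) c) ds) (0 # coeff_mult cs ds)"

lemma int_poly_add: "int_poly (coeff_add cs ds) t = int_poly cs t + int_poly ds t"
  by (induction cs ds rule: coeff_add.induct) (simp_all add: algebra_simps)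

lemma int_poly_map: "int_poly (map ((*) c) ds) t = of_int c * int_poly ds t"
  by (induction ds) (simp_all add: algebra_simps)

lemma int_poly_mult: "int_poly (coeff_mult cs ds) t = int_poly cs t * int_poly ds t"
  by (induction cs) (simp_all add: int_poly_add int_poly_map algebra_simps)

lemma int_poly_rev:
  assumes "t * s = 1"
  shows "t ^ length cs * int_poly cs s = t * int_poly (rev cs) t"
proof (induction cs)
  case (Cons c cs)
  have "t ^ length (c # cs) * int_poly (c # cs) s
      = t ^ Suc (length cs) * of_int c + (t * s) * (t ^ length cs * int_poly cs s)"
    by (simp add: algebra_simps)
  also have "\<dots> = t * int_poly (rev (c # cs)) t"
    unfolding assms Cons.IH by (simp add: horner_sum_append algebra_simps)
  finally show ?case .
qed simp

text \<open>A solution of the norm equation that is not a multiple of an image of \<open>w\<^sub>2\<close> under a word in \<open>\<sigma>\<^sub>2\<close> and \<open>\<sigma>\<^sub>3\<close>.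
It comes from a computer search: completing the square turns the equation into
\<open>P P' + (1 + t + t\<^sup>-\<^sup>1) q q' = 2 + t + t\<^sup>-\<^sup>1\<close> with \<open>P = (1 + t) p - q\<close> and \<open>'\<close> for \<open>t \<mapsto> t\<^sup>-\<^sup>1\<close>. This form is positive definite
on the arc of the unit circle where \<open>1 + t + t\<^sup>-\<^sup>1\<close> is positive, so each degree leaves finitely many candidates.\<close>

definition p_coeffs :: "int list" where
  "p_coeffs = [2, - 4, 5, - 5, 3, 0, - 2, 3, - 3, 2, - 1]"

definition q_coeffs :: "int list" where
  "q_coeffs = [1, - 1, 0, 1, - 2, 2, - 1, 0, 1, - 1, 1]"

definition exotic :: "laurent \<times> laurent \<times> laurent" where
  "exotic = (0, int_poly p_coeffs (tpow 1), int_poly q_coeffs (tpow 1))"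

lemma bar_int_poly: "laurent_bar (int_poly cs (tpow 1)) = int_poly cs (tpow (- 1))"
  by (simp add: laurent_bar_eval bar.eval_int_poly)

lemma exotic_norm:
  fixes t s :: "'a::comm_ring_1"
  assumes ts: "t * s = 1"
  shows "(1 + t) * (int_poly p_coeffs t * int_poly p_coeffs s + int_poly q_coeffs t * int_poly q_coeffs s)
    = t * (int_poly p_coeffs t * int_poly q_coeffs s) + int_poly p_coeffs s * int_poly q_coeffs t + (1 + t)"
    (is "?l = ?r")
proof -
  let ?P = "int_poly p_coeffs t" and ?Q = "int_poly q_coeffs t"
  let ?P' = "int_poly (rev p_coeffs) t" and ?Q' = "int_poly (rev q_coeffs) t"
  have cancel: "s ^ 11 * (t ^ 11 * x) = x" for x
    using ts by (simp add: mult.commute[of s] flip: mult.assoc power_mult_distrib)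
  have rv: "t ^ 11 * int_poly p_coeffs s = t * ?P'" "t ^ 11 * int_poly q_coeffs s = t * ?Q'"
  proof -
    have "length p_coeffs = 11" "length q_coeffs = 11" by (simp_all add: p_coeffs_def q_coeffs_def)
    then show "t ^ 11 * int_poly p_coeffs s = t * ?P'" "t ^ 11 * int_poly q_coeffs s = t * ?Q'"
      using int_poly_rev[OF ts, of p_coeffs] int_poly_rev[OF ts, of q_coeffs] by simp_all
  qed
  \<comment> \<open>The list \<open>replicate 10 0 @ [1, 1]\<close> is \<open>(1 + t) t\<^sup>1\<^sup>0\<close>; the factor \<open>t\<^sup>1\<^sup>0\<close> clears the negative powers of \<open>t\<close>.\<close>
  have "coeff_mult [1, 1] (coeff_add (coeff_mult p_coeffs (rev p_coeffs)) (coeff_mult q_coeffs (rev q_coeffs)))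
      = coeff_add (coeff_add (0 # coeff_mult p_coeffs (rev q_coeffs)) (coeff_mult (rev p_coeffs) q_coeffs))
          (replicate 10 0 @ [1, 1])"
    by (simp add: p_coeffs_def q_coeffs_def numeral_eq_Suc)
  from arg_cong[OF this, of "\<lambda>cs. int_poly cs t"]
  have "(1 + t) * (?P * ?P' + ?Q * ?Q') = t * (?P * ?Q') + ?P' * ?Q + (1 + t) * t ^ 10"
  proof -
    have "int_poly (replicate 10 0 @ [1, 1]) t = (1 + t) * t ^ 10"
      by (simp add: numeral_eq_Suc algebra_simps)
    moreover have "int_poly [1, 1] t = 1 + t" by simp
    moreover have "int_poly (0 # cs) t = t * int_poly cs t" for cs by simp
    ultimately show ?thesis
      using \<open>int_poly (coeff_mult [1, 1] _) t = _\<close> by (simp only: int_poly_mult int_poly_add)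
  qed
  then have "t * ((1 + t) * (?P * ?P' + ?Q * ?Q')) = t * (t * (?P * ?Q') + ?P' * ?Q + (1 + t) * t ^ 10)"
    by simp
  also have "t * ((1 + t) * (?P * ?P' + ?Q * ?Q')) = (1 + t) * (?P * (t * ?P') + ?Q * (t * ?Q'))"
    by (simp add: algebra_simps)
  also have "\<dots> = t ^ 11 * ?l"
    by (simp only: rv[symmetric]) (simp add: algebra_simps)
  also have "t * (t * (?P * ?Q') + ?P' * ?Q + (1 + t) * t ^ 10) = t * (?P * (t * ?Q')) + (t * ?P') * ?Q + t ^ 11 * (1 + t)"
    by (simp add: algebra_simps numeral_eq_Suc)
  also have "\<dots> = t ^ 11 * ?r"
    by (simp only: rv[symmetric]) (simp add: algebra_simps)
  finally have "s ^ 11 * (t ^ 11 * ?l) = s ^ 11 * (t ^ 11 * ?r)" by simp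
  then show ?thesis by (simp only: cancel)
qed

lemma is_root_exotic: "is_root exotic"
  using exotic_norm[OF t_cancel(1)] by (simp add: exotic_def bar_int_poly)

text \<open>At \<open>t = 1\<close> the root has \<open>p = 0\<close> and \<open>q = 1\<close>, as \<open>w\<^sub>3\<close> has, so its reflection is the transposition that \<open>\<sigma>\<^sub>3\<close>
induces.\<close>

lemma exotic_perm:
  "map_mat laurent_at_1 (refl_mat 4 (root_col exotic) (root_row exotic)) \<in> permutation_matrices 4"
proof (rule transposition_matrix[of 2 _ 3])
  have at1: "laurent_eval (\<lambda>_. 1) (int_poly p_coeffs (tpow i)) = (0::int)"
    "laurent_eval (\<lambda>_. 1) (int_poly q_coeffs (tpow i)) = (1::int)" for i
    unfolding at_1.eval_int_poly by (simp_all add: p_coeffs_def q_coeffs_def)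
  fix k l :: nat assume "k < 4" "l < 4"
  then show "map_mat laurent_at_1 (refl_mat 4 (root_col exotic) (root_row exotic)) $$ (k, l)
      = (if k = transpose 2 3 l then 1 else 0)"
    unfolding less_4
    by (elim disjE)
      (simp_all add: exotic_def bar_int_poly at1 laurent_at_1_eval Let_def transpose_def)
qed auto

fun pairing :: "laurent \<times> laurent \<times> laurent \<Rightarrow> laurent \<times> laurent \<times> laurent \<Rightarrow> laurent" where
  "pairing r (x, y, z) = red_row r 0 * x + red_row r 1 * y + red_row r 2 * z"

fun reflect :: "laurent \<times> laurent \<times> laurent \<Rightarrow> laurent \<times> laurent \<times> laurent \<Rightarrow> laurent \<times> laurent \<times> laurent" where
  "reflect (a, b, c) (x, y, z) =
    (let k = pairing (a, b, c) (x, y, z) in (x + k * a, y + k * b, z + k * c))"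

lemma exotic_at_3:
  "at_3_pair (reflect exotic (0, 1, 0)) = (4495676129 / 59049, - 6001227173 / 59049)"
proof -
  have third: "3 powi - 1 = (1 / 3 :: real)" by (simp add: power_int_minus)
  have 3: "laurent_eval (\<lambda>k. 3 powi k) (int_poly p_coeffs (tpow 1)) = (- 34120 :: real)"
    "laurent_eval (\<lambda>k. 3 powi k) (int_poly q_coeffs (tpow 1)) = (45547 :: real)"
    "laurent_eval (\<lambda>k. 3 powi k) (int_poly p_coeffs (tpow (- 1))) = (63320 / 59049 :: real)"
    "laurent_eval (\<lambda>k. 3 powi k) (int_poly q_coeffs (tpow (- 1))) = (40507 / 59049 :: real)"
    unfolding at_3.eval_int_poly by (simp_all add: p_coeffs_def q_coeffs_def third)
  show ?thesis
    by (simp add: exotic_def bar_int_poly Let_def 3)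
qed

lemma exotic_not_reach: "\<not> reach (at_3_pair (reflect exotic (0, 1, 0)))"
  unfolding exotic_at_3 reach_def by (auto dest!: pong_cone)

text \<open>A braid that commutes with the twist maps \<open>w\<^sub>2\<close> to a multiple of a vector that \<open>reach\<close> contains, whereas
the reflection in the exotic root does not.\<close>

lemma exotic_not_braid:
  assumes "w \<in> braid_words 4" "braid_eq 4 (w @ half_twist_sq) (half_twist_sq @ w)"
    and "foldr burau_step w (0, 1, 0) = (x, y, z)"
  shows "reflect exotic (0, 1, 0) \<noteq> (k * x, k * y, k * z)"
proof
  assume eq: "reflect exotic (0, 1, 0) = (k * x, k * y, k * z)"
  obtain l p q where l: "foldr burau_step w (0, 1, 0) = (0, l * p, l * q)"
    and pq: "foldr burau_step (three_part w) (0, 1, 0) = (0, p, q)"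
    using burau_centralizer[OF assms(1,2)] .
  let ?e = "laurent_eval (\<lambda>k. (3::real) powi k)"
  have r: "reach (?e p, ?e q)"
    using reach_three_word[OF three_part_letters[OF assms(1)]] by (simp add: pq)
  have v: "at_3_pair (reflect exotic (0, 1, 0)) = (?e (k * l) * ?e p, ?e (k * l) * ?e q)"
    using l assms(3) by (simp add: eq mult.assoc)
  show False
  proof (cases "?e (k * l) = 0")
    case True
    then show False using v by (simp only: exotic_at_3 True) simp
  next
    case False
    then show False using v r reach_scale[OF False, of "?e p" "?e q"] exotic_not_reach by simp
  qed
qed

section \<open>Matrices that act on the Burau module\<close>

lemma mat_eq_iff_vec:
  fixes A :: "'a::comm_ring_1 mat"
  assumes "A \<in> carrier_mat n n" "B \<in> carrier_mat n n" "\<And>v. v \<in> carrier_vec n \<Longrightarrow> A *\<^sub>v v = B *\<^sub>v v"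
  shows "A = B"
proof (rule eq_matI)
  fix i j assume "i < dim_row B" "j < dim_col B"
  then have ij: "i < n" "j < n" using assms by auto
  have "(A *\<^sub>v unit_vec n j) $ i = (B *\<^sub>v unit_vec n j) $ i" using assms by simp
  then show "A $$ (i, j) = B $$ (i, j)" using ij assms(1,2) by simp
qed (use assms in auto)

lemma mult_mat_smult_vec:
  fixes A :: "'a::comm_ring_1 mat"
  assumes "A \<in> carrier_mat n m" "v \<in> carrier_vec m"
  shows "A *\<^sub>v (k \<cdot>\<^sub>v v) = k \<cdot>\<^sub>v (A *\<^sub>v v)"
  using assms by (intro eq_vecI) auto

lemma braid_words_Cons: "(i, e) # w \<in> braid_words 4 \<longleftrightarrow> i \<in> {1,2,3} \<and> w \<in> braid_words 4"
  by (auto simp: braid_words_def)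

lemma word_eval_carrier:
  assumes "group G" "\<And>i. i \<in> {1,2,3} \<Longrightarrow> g i \<in> carrier G" "w \<in> braid_words 4"
  shows "word_eval G g w \<in> carrier G"
proof -
  interpret group G by fact
  show ?thesis using assms(3)
  proof (induction w)
    case (Cons l w)
    then show ?case using assms(2)
      by (cases l) (auto simp: word_eval_def braid_words_Cons)
  qed (simp add: word_eval_def)
qed

lemma word_eval_append:
  assumes "group G" "\<And>i. i \<in> {1,2,3} \<Longrightarrow> g i \<in> carrier G" "u \<in> braid_words 4" "v \<in> braid_words 4"
  shows "word_eval G g (u @ v) = word_eval G g u \<otimes>\<^bsub>G\<^esub> word_eval G g v"
proof -
  interpret group G by fact
  have v: "word_eval G g v \<in> carrier G" by (rule word_eval_carrier) fact+
  show ?thesis using assms(3)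
  proof (induction u)
    case Nil
    then show ?case using v by (simp add: word_eval_def)
  next
    case (Cons l u)
    obtain i e where l: "l = (i, e)" by (cases l)
    have u: "word_eval G g u \<in> carrier G" and gi: "g i \<in> carrier G"
      using Cons.prems assms(2) word_eval_carrier[OF assms(1,2), where w = u] by (auto simp: l braid_words_Cons)
    have "word_eval G g (l # u @ v) = (if e then g i else inv\<^bsub>G\<^esub> (g i)) \<otimes>\<^bsub>G\<^esub> word_eval G g (u @ v)"
      by (simp add: word_eval_def l)
    also have "\<dots> = (if e then g i else inv\<^bsub>G\<^esub> (g i)) \<otimes>\<^bsub>G\<^esub> word_eval G g u \<otimes>\<^bsub>G\<^esub> word_eval G g v"
      using Cons u v gi by (simp add: l braid_words_Cons m_assoc)
    also have "\<dots> = word_eval G g (l # u) \<otimes>\<^bsub>G\<^esub> word_eval G g v"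
      by (simp add: word_eval_def l)
    finally show ?case by simp
  qed
qed

lemma GL_carrier_mat: "A \<in> carrier (GL n) \<Longrightarrow> A \<in> carrier_mat n n"
  by (simp add: GL_simps)

lemma word_eval_vec:
  assumes g: "\<And>i. i \<in> {1,2,3} \<Longrightarrow> g i \<in> carrier (GL n)"
    and act: "\<And>i v. i \<in> {1,2,3} \<Longrightarrow> g i *\<^sub>v emb v = emb (step (i, True) v)"
    and inv: "\<And>i v. i \<in> {1,2,3} \<Longrightarrow> step (i, True) (step (i, False) v) = v"
    and emb: "\<And>v. emb v \<in> carrier_vec n"
    and w: "w \<in> braid_words 4"
  shows "word_eval (GL n) g w *\<^sub>v emb v = emb (foldr step w v)"
  using w
proof (induction w)
  case Nil
  then show ?case using emb by (simp add: word_eval_def GL_simps)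
next
  case (Cons l w)
  interpret GL: group "GL n" by (rule group_GL)
  obtain i e where l: "l = (i, e)" by (cases l)
  have i: "i \<in> {1,2,3}" and w: "w \<in> braid_words 4" using Cons.prems by (auto simp: l braid_words_Cons)
  have W: "word_eval (GL n) g w \<in> carrier_mat n n"
    by (rule GL_carrier_mat[OF word_eval_carrier[where g = g, OF group_GL g w]])
  have gi: "g i \<in> carrier_mat n n" "inv\<^bsub>GL n\<^esub> g i \<in> carrier_mat n n"
    by (rule GL_carrier_mat[OF g[OF i]], rule GL_carrier_mat[OF GL.inv_closed[OF g[OF i]]])
  have letter: "(if e then g i else inv\<^bsub>GL n\<^esub> g i) *\<^sub>v emb u = emb (step (i, e) u)" for u
  proof (cases e)
    case True
    then show ?thesis using act[OF i] by simp
  next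
    case False
    have "inv\<^bsub>GL n\<^esub> g i * g i = 1\<^sub>m n"
      using GL.l_inv[OF g[OF i]] by (simp add: GL_simps)
    then have "inv\<^bsub>GL n\<^esub> g i *\<^sub>v (g i *\<^sub>v emb (step (i, False) u)) = emb (step (i, False) u)"
      using assoc_mult_mat_vec[OF gi(2,1) emb, symmetric] emb by simp
    then show ?thesis using False by (simp add: act[OF i] inv[OF i])
  qed
  have "word_eval (GL n) g (l # w) = (if e then g i else inv\<^bsub>GL n\<^esub> g i) * word_eval (GL n) g w"
    by (simp add: word_eval_def l GL_simps)
  then have "word_eval (GL n) g (l # w) *\<^sub>v emb v
      = (if e then g i else inv\<^bsub>GL n\<^esub> g i) *\<^sub>v (word_eval (GL n) g w *\<^sub>v emb v)"
    using gi W emb assoc_mult_mat_vec[of "if e then g i else inv\<^bsub>GL n\<^esub> g i" n n "word_eval (GL n) g w" n "emb v"]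
    by (auto split: if_splits)
  then show ?case using Cons.IH[OF w] letter by (simp add: l)
qed

text \<open>A copy of the Burau module inside \<open>n\<close>-dimensional columns, in which \<open>row r\<close> is the row of the reflection in
\<open>r\<close>. It covers the reduced representation (\<open>n = 3\<close>) and the unreduced one (\<open>n = 4\<close>), so that the argument is
made once.\<close>

locale burau_model =
  fixes n :: nat and col row :: "laurent \<times> laurent \<times> laurent \<Rightarrow> nat \<Rightarrow> laurent"
  assumes pair: "(\<Sum>k<n. row r k * col v k) = pairing r v"
    and lin: "col (x, y, z) i = x * col (unit_root 1) i + y * col (unit_root 2) i + z * col (unit_root 3) i"
    and inj: "(\<And>i. i < n \<Longrightarrow> col v i = col v' i) \<Longrightarrow> v = v'"
begin

definition embed :: "laurent \<times> laurent \<times> laurent \<Rightarrow> laurent vec" where "embed v = vec n (col v)"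

lemma embed_carrier [simp]: "embed v \<in> carrier_vec n" "dim_vec (embed v) = n"
  by (simp_all add: embed_def)

lemma embed_inj: "embed v = embed v' \<Longrightarrow> v = v'"
  by (rule inj) (metis embed_def index_vec)

lemma embed_smult: "k \<cdot>\<^sub>v embed (x, y, z) = embed (k * x, k * y, k * z)"
  by (rule eq_vecI) (simp_all add: embed_def lin[of x y z] lin[of "k * x" "k * y" "k * z"] algebra_simps)

lemma embed_add: "embed (x, y, z) + embed (x', y', z') = embed (x + x', y + y', z + z')"
  by (rule eq_vecI)
    (simp_all add: embed_def lin[of x y z] lin[of x' y' z'] lin[of "x + x'" "y + y'" "z + z'"] algebra_simps)

lemma sum_row_embed: "(\<Sum>k<n. row r k * embed v $ k) = pairing r v"
  unfolding pair[symmetric] by (intro sum.cong) (auto simp: embed_def)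

lemma refl_embed: "refl_mat n (col r) (row r) *\<^sub>v embed v = embed (reflect r v)"
proof -
  obtain a b c x y z where r: "r = (a, b, c)" "v = (x, y, z)" by (cases r; cases v)
  have "refl_mat n (col r) (row r) *\<^sub>v embed v = embed v + pairing r v \<cdot>\<^sub>v embed r"
    by (simp add: refl_mat_vec sum_row_embed embed_def[of r])
  then show ?thesis by (simp add: r embed_smult embed_add Let_def)
qed

text \<open>The reflection in \<open>w\<^sub>i\<close> differs from the identity by a map onto the multiples of \<open>w\<^sub>i\<close>, so a matrix that
commutes with it maps \<open>w\<^sub>i\<close> to a multiple \<open>k\<^sub>i w\<^sub>i\<close>. Pairing \<open>w\<^sub>i\<close> with its neighbour shows that neighbouring factors
\<open>k\<^sub>i\<close> agree. The pairings used here are units, so nothing has to be divided.\<close>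

lemma central_scalar:
  assumes z: "z \<in> carrier_mat n n"
    and comm: "\<And>i. i \<in> {1,2,3} \<Longrightarrow>
      z * refl_mat n (col (unit_root i)) (row (unit_root i)) = refl_mat n (col (unit_root i)) (row (unit_root i)) * z"
  obtains k where "\<And>v. z *\<^sub>v embed v = k \<cdot>\<^sub>v embed v"
proof -
  have dz: "dim_row z = n" "dim_col z = n" using z by auto
  define f where "f i w = (\<Sum>k<n. row (unit_root i) k * w $ k)" for i and w :: "laurent vec"
  have f_embed: "f i (c \<cdot>\<^sub>v embed v) = c * pairing (unit_root i) v" for i c v
    by (simp add: f_def mult.left_commute sum_row_embed flip: sum_distrib_left del: unit_root.simps)
  have R: "refl_mat n (col (unit_root i)) (row (unit_root i)) *\<^sub>v w = w + f i w \<cdot>\<^sub>v embed (unit_root i)"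
    if "w \<in> carrier_vec n" for i w
    using that by (simp add: refl_mat_vec f_def embed_def)
  have key: "pairing (unit_root i) (unit_root j) \<cdot>\<^sub>v (z *\<^sub>v embed (unit_root i)) = f i (z *\<^sub>v embed (unit_root j)) \<cdot>\<^sub>v embed (unit_root i)"
    if i: "i \<in> {1,2,3}" for i j
  proof -
    let ?R = "refl_mat n (col (unit_root i)) (row (unit_root i))" and ?c = "pairing (unit_root i) (unit_root j)"
    have zj: "z *\<^sub>v embed (unit_root j) \<in> carrier_vec n" and zi: "z *\<^sub>v embed (unit_root i) \<in> carrier_vec n"
      using z by (auto intro: mult_mat_vec_carrier)
    have "z *\<^sub>v embed (unit_root j) + ?c \<cdot>\<^sub>v (z *\<^sub>v embed (unit_root i)) = z *\<^sub>v (embed (unit_root j) + ?c \<cdot>\<^sub>v embed (unit_root i))"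
      using z by (simp add: mult_add_distrib_mat_vec[OF z] mult_mat_smult_vec[OF z])
    also have "\<dots> = z *\<^sub>v (?R *\<^sub>v embed (unit_root j))"
      using R[of "embed (unit_root j)" i] f_embed[of i 1 "unit_root j"] by simp
    also have "\<dots> = ?R *\<^sub>v (z *\<^sub>v embed (unit_root j))"
      using assoc_mult_mat_vec[OF z refl_mat_carrier(1) embed_carrier(1)]
        assoc_mult_mat_vec[OF refl_mat_carrier(1) z embed_carrier(1)] comm[OF i] by metis
    also have "\<dots> = z *\<^sub>v embed (unit_root j) + f i (z *\<^sub>v embed (unit_root j)) \<cdot>\<^sub>v embed (unit_root i)"
      by (rule R[OF zj])
    finally have eq: "z *\<^sub>v embed (unit_root j) + ?c \<cdot>\<^sub>v (z *\<^sub>v embed (unit_root i))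
        = z *\<^sub>v embed (unit_root j) + f i (z *\<^sub>v embed (unit_root j)) \<cdot>\<^sub>v embed (unit_root i)" .
    show ?thesis
    proof (rule eq_vecI)
      fix m assume "m < dim_vec (f i (z *\<^sub>v embed (unit_root j)) \<cdot>\<^sub>v embed (unit_root i))"
      then have m: "m < n" by simp
      from arg_cong[OF eq, of "\<lambda>v. v $ m"] show "(?c \<cdot>\<^sub>v (z *\<^sub>v embed (unit_root i))) $ m
          = (f i (z *\<^sub>v embed (unit_root j)) \<cdot>\<^sub>v embed (unit_root i)) $ m"
        using m dz by (simp del: index_mult_mat_vec)
    qed (use dz in simp)
  qed
  have p: "pairing (unit_root 1) (unit_root 2) = 1" "pairing (unit_root 2) (unit_root 3) = 1"
    "pairing (unit_root 3) (unit_root 2) = tpow 1"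
    by (simp_all add: Let_def)
  define k where "k = f 1 (z *\<^sub>v embed (unit_root 2))"
  define k2 where "k2 = f 2 (z *\<^sub>v embed (unit_root 3))"
  define k3 where "k3 = tpow (- 1) * f 3 (z *\<^sub>v embed (unit_root 2))"
  have z1: "z *\<^sub>v embed (unit_root 1) = k \<cdot>\<^sub>v embed (unit_root 1)"
    using key[of 1 2] by (simp only: p k_def) simp
  have z2: "z *\<^sub>v embed (unit_root 2) = k2 \<cdot>\<^sub>v embed (unit_root 2)"
    using key[of 2 3] by (simp only: p k2_def) simp
  have z3: "z *\<^sub>v embed (unit_root 3) = k3 \<cdot>\<^sub>v embed (unit_root 3)"
  proof -
    have "tpow (- 1) \<cdot>\<^sub>v (tpow 1 \<cdot>\<^sub>v (z *\<^sub>v embed (unit_root 3)))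
        = tpow (- 1) \<cdot>\<^sub>v (f 3 (z *\<^sub>v embed (unit_root 2)) \<cdot>\<^sub>v embed (unit_root 3))"
      using key[of 3 2] by (simp only: p) simp
    then show ?thesis by (simp add: smult_smult_assoc t_cancel k3_def)
  qed
  have "k = k2" using f_embed[of 1 k2 "unit_root 2"] by (simp only: k_def z2 p) simp
  moreover have "k2 = k3" using f_embed[of 2 k3 "unit_root 3"] by (simp only: k2_def z3 p) simp
  ultimately have zu: "z *\<^sub>v embed (unit_root i) = k \<cdot>\<^sub>v embed (unit_root i)" if "i \<in> {1,2,3}" for i
    using that z1 z2 z3 by auto
  have "z *\<^sub>v embed v = k \<cdot>\<^sub>v embed v" for v
  proof -
    obtain x y w where v: "v = (x, y, w)" by (cases v)
    have ev: "embed v = x \<cdot>\<^sub>v embed (unit_root 1) + y \<cdot>\<^sub>v embed (unit_root 2) + w \<cdot>\<^sub>v embed (unit_root 3)"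
      by (simp add: v embed_smult embed_add)
    have "z *\<^sub>v embed v = x \<cdot>\<^sub>v (z *\<^sub>v embed (unit_root 1)) + y \<cdot>\<^sub>v (z *\<^sub>v embed (unit_root 2)) + w \<cdot>\<^sub>v (z *\<^sub>v embed (unit_root 3))"
      unfolding ev using mult_add_distrib_mat_vec[OF z] mult_mat_smult_vec[OF z]
      by (metis add_carrier_vec embed_carrier(1) smult_carrier_vec)
    also have "\<dots> = k \<cdot>\<^sub>v embed v"
      unfolding ev by (simp only: zu insertI1 insertI2)
        (rule eq_vecI; simp add: algebra_simps)
    finally show ?thesis .
  qed
  then show ?thesis by (rule that)
qed

lemma exotic_not_central_multiple:
  assumes z: "z \<in> carrier_mat n n"
    and comm: "\<And>i. i \<in> {1,2,3} \<Longrightarrow>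
      z * refl_mat n (col (unit_root i)) (row (unit_root i)) = refl_mat n (col (unit_root i)) (row (unit_root i)) * z"
    and w: "w \<in> braid_words 4" "braid_eq 4 (w @ half_twist_sq) (half_twist_sq @ w)"
    and B: "B \<in> carrier_mat n n" "\<And>v. B *\<^sub>v embed v = embed (foldr burau_step w v)"
  shows "refl_mat n (col exotic) (row exotic) \<noteq> z * B"
proof
  assume eq: "refl_mat n (col exotic) (row exotic) = z * B"
  obtain k where k: "\<And>v. z *\<^sub>v embed v = k \<cdot>\<^sub>v embed v"
    using central_scalar[OF z comm] by blast
  obtain x y u where xyu: "foldr burau_step w (0, 1, 0) = (x, y, u)" by (cases "foldr burau_step w (0, 1, 0)")
  have "embed (reflect exotic (0, 1, 0)) = z *\<^sub>v (B *\<^sub>v embed (0, 1, 0))"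
    unfolding refl_embed[symmetric] eq by (rule assoc_mult_mat_vec[OF z B(1)]) simp
  also have "\<dots> = embed (k * x, k * y, k * u)"
    by (simp add: B(2) xyu k embed_smult)
  finally show False
    using exotic_not_braid[OF w xyu] embed_inj by blast
qed

end

interpretation red: burau_model 3 coord red_row
proof
  show "(\<Sum>k<3. red_row r k * coord v k) = pairing r v" for r v
    by (cases v) (simp add: sum_lessThan_3)
  show "coord (x, y, z) i = x * coord (unit_root 1) i + y * coord (unit_root 2) i + z * coord (unit_root 3) i" for x y z i
    by simp
  show "v = v'" if "\<And>i. i < 3 \<Longrightarrow> coord v i = coord v' i" for v v'
    using that[of 0] that[of 1] that[of 2] by (cases v; cases v') simp
qed

interpretation unr: burau_model 4 root_col root_row
proof
  show "(\<Sum>k<4. root_row r k * root_col v k) = pairing r v" for r v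
    by (cases r; cases v) (simp add: sum_lessThan_4 Let_def algebra_simps tpow_mult tpow_mult_left tpow_0)
  show "root_col (x, y, z) i = x * root_col (unit_root 1) i + y * root_col (unit_root 2) i + z * root_col (unit_root 3) i" for x y z i
    by (simp add: algebra_simps)
  show "v = v'" if "\<And>i. i < 4 \<Longrightarrow> root_col v i = root_col v' i" for v v'
  proof -
    obtain a b c a' b' c' where v: "v = (a, b, c)" "v' = (a', b', c')" by (cases v; cases v')
    have "a = a'" using that[of 0] by (simp add: v)
    moreover have "tpow (- 1) * (b - a) = tpow (- 1) * (b' - a')" using that[of 1] by (simp add: v)
    then have "tpow 1 * (tpow (- 1) * (b - a)) = tpow 1 * (tpow (- 1) * (b' - a'))" by simp
    then have "b - a = b' - a'" by (simp only: t_cancel)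
    moreover have "tpow (- 3) * c = tpow (- 3) * c'" using that[of 3] by (simp add: v)
    then have "tpow 3 * (tpow (- 3) * c) = tpow 3 * (tpow (- 3) * c')" by simp
    then have "c = c'" by (simp add: tpow_mult_left tpow_0)
    ultimately show ?thesis by (simp add: v)
  qed
qed

section \<open>The two Burau representations of words\<close>

type_synonym laurent4 = "laurent \<times> laurent \<times> laurent \<times> laurent"

text \<open>The Burau module does not span all columns of length 4. That the unreduced matrix of a word depends only
on the braid, and that the witness commutes with the twist, is seen from the action on all columns.\<close>

fun burau_u_step :: "nat \<times> bool \<Rightarrow> laurent4 \<Rightarrow> laurent4" where
  "burau_u_step (i, s) (a, b, c, d) =
    (let f = (\<lambda>x y. if s then ((1 - tpow 1) * x + tpow 1 * y, x) else (y, tpow (- 1) * (x - y) + y)) in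
     if i = 1 then (let (a, b) = f a b in (a, b, c, d))
     else if i = 2 then (let (b, c) = f b c in (a, b, c, d))
     else (let (c, d) = f c d in (a, b, c, d)))"

interpretation burau_u: braid_action burau_u_step
proof (unfold_locales, goal_cases)
  case (1 i b v)
  then show ?case by (cases v; cases b) (auto simp: Let_def algebra_simps t_cancel)
next
  case (2 v)
  show ?case by (cases v) (simp add: Let_def)
next
  case (3 v)
  show ?case by (cases v) (simp add: Let_def algebra_simps)
next
  case (4 v)
  show ?case by (cases v) (simp add: Let_def algebra_simps)
qed

fun coord4 :: "laurent4 \<Rightarrow> nat \<Rightarrow> laurent" where
  "coord4 (a, b, c, d) i = (if i = 0 then a else if i = 1 then b else if i = 2 then c else d)"

definition vec4 :: "laurent4 \<Rightarrow> laurent vec" where "vec4 v = vec 4 (coord4 v)"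

lemma vec4_carrier [simp]: "vec4 v \<in> carrier_vec 4" "dim_vec (vec4 v) = 4"
  by (simp_all add: vec4_def)

lemma vec4_surj:
  assumes "w \<in> carrier_vec 4" shows "\<exists>v. w = vec4 v"
proof
  show "w = vec4 (w $ 0, w $ 1, w $ 2, w $ 3)"
    using assms by (intro eq_vecI) (auto simp: vec4_def less_4)
qed

lemma red_surj:
  assumes "w \<in> carrier_vec 3" shows "\<exists>v. w = red.embed v"
proof
  show "w = red.embed (w $ 0, w $ 1, w $ 2)"
    using assms by (intro eq_vecI) (auto simp: red.embed_def less_3)
qed

lemma refl_mat_vec4:
  "refl_mat 4 x y *\<^sub>v vec4 (a, b, c, d) =
    (let k = y 0 * a + y 1 * b + y 2 * c + y 3 * d in vec4 (a + k * x 0, b + k * x 1, c + k * x 2, d + k * x 3))"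
proof -
  have "refl_mat 4 x y *\<^sub>v vec4 (a, b, c, d)
      = vec4 (a, b, c, d) + (y 0 * a + y 1 * b + y 2 * c + y 3 * d) \<cdot>\<^sub>v vec 4 x"
    by (simp add: refl_mat_vec sum_lessThan_4 vec4_def)
  then show ?thesis
    by (intro eq_vecI) (auto simp: Let_def vec4_def less_4)
qed

lemma burau_u_gen_vec4:
  assumes "i \<in> {1,2,3}"
  shows "burau_u_gen 4 i *\<^sub>v vec4 v = vec4 (burau_u_step (i, True) v)"
  unfolding burau_u_gen_refl[OF assms] using assms
  by (cases v; elim insertE)
    (simp_all add: refl_mat_vec4 Let_def algebra_simps tpow_mult tpow_mult_left tpow_0)

lemma burau_r_gen_vec:
  assumes "i \<in> {1,2,3}"
  shows "burau_r_gen 4 i *\<^sub>v red.embed v = red.embed (burau_step (i, True) v)"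
  unfolding burau_r_gen_refl[OF assms] red.refl_embed using assms
  by (cases v; elim insertE) (simp_all add: Let_def algebra_simps)

lemma burau_u_gen_vec:
  assumes "i \<in> {1,2,3}"
  shows "burau_u_gen 4 i *\<^sub>v unr.embed v = unr.embed (burau_step (i, True) v)"
  unfolding burau_u_gen_refl[OF assms] unr.refl_embed using assms
  by (cases v; elim insertE) (simp_all add: Let_def algebra_simps)

lemma burau_u_gen_Gamma: "i \<in> {1,2,3} \<Longrightarrow> burau_u_gen 4 i \<in> carrier (Gamma 4)"
  using refl_root_Gamma[OF is_root_unit unit_root_perm] burau_u_gen_refl by simp

lemma burau_r_gen_Gamma: "i \<in> {1,2,3} \<Longrightarrow> burau_r_gen 4 i \<in> carrier (Gamma_red 4)"
  using refl_root_Gamma_red[OF is_root_unit unit_root_perm] burau_r_gen_refl by simp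

lemma Gamma_GL: "carrier (Gamma n) \<subseteq> carrier (GL n)" "carrier (Gamma_red n) \<subseteq> carrier (GL (n - 1))"
  by (auto simp: Gamma_def Gamma_red_def)

lemma burau_u_gen_GL: "i \<in> {1,2,3} \<Longrightarrow> burau_u_gen 4 i \<in> carrier (GL 4)"
  using burau_u_gen_Gamma Gamma_GL by blast

lemma burau_r_gen_GL: "i \<in> {1,2,3} \<Longrightarrow> burau_r_gen 4 i \<in> carrier (GL 3)"
  using burau_r_gen_Gamma Gamma_GL(2)[of 4] by auto

abbreviation u_eval :: "braid_word \<Rightarrow> laurent mat" where
  "u_eval \<equiv> word_eval (GL 4) (burau_u_gen 4)"

abbreviation r_eval :: "braid_word \<Rightarrow> laurent mat" where
  "r_eval \<equiv> word_eval (GL 3) (burau_r_gen 4)"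

lemma u_eval_vec4: "w \<in> braid_words 4 \<Longrightarrow> u_eval w *\<^sub>v vec4 v = vec4 (foldr burau_u_step w v)"
  by (rule word_eval_vec) (simp_all only: burau_u_gen_GL burau_u_gen_vec4 burau_u.act_cancel vec4_carrier simp_thms,
    use burau_u.act_cancel[of _ True] in simp)

lemma u_eval_embed: "w \<in> braid_words 4 \<Longrightarrow> u_eval w *\<^sub>v unr.embed v = unr.embed (foldr burau_step w v)"
  by (rule word_eval_vec) (simp_all only: burau_u_gen_GL burau_u_gen_vec unr.embed_carrier simp_thms,
    use burau.act_cancel[of _ True] in simp)

lemma r_eval_embed: "w \<in> braid_words 4 \<Longrightarrow> r_eval w *\<^sub>v red.embed v = red.embed (foldr burau_step w v)"
  by (rule word_eval_vec) (simp_all only: burau_r_gen_GL burau_r_gen_vec red.embed_carrier simp_thms,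
    use burau.act_cancel[of _ True] in simp)

lemma eval_carrier:
  assumes "w \<in> braid_words 4"
  shows "u_eval w \<in> carrier (GL 4)" "r_eval w \<in> carrier (GL 3)"
    "u_eval w \<in> carrier_mat 4 4" "r_eval w \<in> carrier_mat 3 3"
proof -
  show u: "u_eval w \<in> carrier (GL 4)" by (rule word_eval_carrier[OF group_GL burau_u_gen_GL assms])
  show r: "r_eval w \<in> carrier (GL 3)" by (rule word_eval_carrier[OF group_GL burau_r_gen_GL assms])
  show "u_eval w \<in> carrier_mat 4 4" "r_eval w \<in> carrier_mat 3 3"
    using GL_carrier_mat[OF u] GL_carrier_mat[OF r] by simp_all
qed

lemma u_eval_cong:
  assumes "braid_eq 4 u v" "u \<in> braid_words 4" "v \<in> braid_words 4"
  shows "u_eval u = u_eval v"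
proof (rule mat_eq_iff_vec)
  fix w :: "laurent vec" assume "w \<in> carrier_vec 4"
  then obtain x where "w = vec4 x" using vec4_surj by blast
  then show "u_eval u *\<^sub>v w = u_eval v *\<^sub>v w"
    using assms by (simp add: u_eval_vec4 burau_u.braid_eq_imp_eq)
qed (use assms eval_carrier in blast)+

lemma r_eval_cong:
  assumes "braid_eq 4 u v" "u \<in> braid_words 4" "v \<in> braid_words 4"
  shows "r_eval u = r_eval v"
proof (rule mat_eq_iff_vec)
  fix w :: "laurent vec" assume "w \<in> carrier_vec 3"
  then obtain x where "w = red.embed x" using red_surj by blast
  then show "r_eval u *\<^sub>v w = r_eval v *\<^sub>v w"
    using assms by (simp add: r_eval_embed burau.braid_eq_imp_eq)
qed (use assms eval_carrier in blast)+

lemma half_twist_sq_word: "half_twist_sq \<in> braid_words 4"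
  by (simp add: half_twist_sq_def braid_words_def)

text \<open>The twist multiplies both the root and the row of its reflection by \<open>t\<^sup>3\<close>.\<close>

lemma exotic_commute_red:
  "refl_mat 3 (coord exotic) (red_row exotic) * r_eval half_twist_sq
    = r_eval half_twist_sq * refl_mat 3 (coord exotic) (red_row exotic)"
proof (rule mat_eq_iff_vec[of _ 3])
  note X = eval_carrier(4)[OF half_twist_sq_word]
  note A = refl_mat_carrier(1)[of 3 "coord exotic" "red_row exotic"]
  show "refl_mat 3 (coord exotic) (red_row exotic) * r_eval half_twist_sq \<in> carrier_mat 3 3"
    "r_eval half_twist_sq * refl_mat 3 (coord exotic) (red_row exotic) \<in> carrier_mat 3 3"
    using mult_carrier_mat[OF A X] mult_carrier_mat[OF X A] by simp_all
  fix w :: "laurent vec" assume w: "w \<in> carrier_vec 3"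
  obtain p q where ex: "exotic = (0, p, q)" by (simp add: exotic_def)
  obtain x where x: "w = red.embed x" using red_surj[OF w] by blast
  have "reflect exotic (foldr burau_step half_twist_sq x) = foldr burau_step half_twist_sq (reflect exotic x)"
    unfolding ex by (cases x) (simp add: half_twist_sq_def Let_def algebra_simps)
  then show "refl_mat 3 (coord exotic) (red_row exotic) * r_eval half_twist_sq *\<^sub>v w
      = r_eval half_twist_sq * refl_mat 3 (coord exotic) (red_row exotic) *\<^sub>v w"
    using assoc_mult_mat_vec[OF A X w] assoc_mult_mat_vec[OF X A w]
    by (simp add: x r_eval_embed[OF half_twist_sq_word] red.refl_embed)
qed

text \<open>On the last three coordinates the full twist is \<open>t\<^sup>3\<close> on the kernel of the row \<open>(1, t, t\<^sup>2)\<close> and fixes the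
column of ones.\<close>

lemma half_twist_sq_u_step:
  "foldr burau_u_step half_twist_sq (a, b, c, d) =
    (let k = (1 - tpow 1) * (b + tpow 1 * c + tpow 2 * d)
     in (a, tpow 3 * b + k, tpow 3 * c + k, tpow 3 * d + k))"
  by (simp add: half_twist_sq_def Let_def algebra_simps tpow_mult tpow_mult_left tpow_0)

lemma exotic_commute_unr:
  "refl_mat 4 (root_col exotic) (root_row exotic) * u_eval half_twist_sq
    = u_eval half_twist_sq * refl_mat 4 (root_col exotic) (root_row exotic)"
proof (rule mat_eq_iff_vec[of _ 4])
  note X = eval_carrier(3)[OF half_twist_sq_word]
  note A = refl_mat_carrier(1)[of 4 "root_col exotic" "root_row exotic"]
  show "refl_mat 4 (root_col exotic) (root_row exotic) * u_eval half_twist_sq \<in> carrier_mat 4 4"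
    "u_eval half_twist_sq * refl_mat 4 (root_col exotic) (root_row exotic) \<in> carrier_mat 4 4"
    using mult_carrier_mat[OF A X] mult_carrier_mat[OF X A] by simp_all
  fix w :: "laurent vec" assume w: "w \<in> carrier_vec 4"
  obtain p q where ex: "exotic = (0, p, q)" by (simp add: exotic_def)
  obtain a b c d where x: "w = vec4 (a, b, c, d)" using vec4_surj[OF w] by auto
  have AX: "refl_mat 4 (root_col exotic) (root_row exotic) * u_eval half_twist_sq *\<^sub>v w
      = refl_mat 4 (root_col exotic) (root_row exotic) *\<^sub>v vec4 (foldr burau_u_step half_twist_sq (a, b, c, d))"
    unfolding assoc_mult_mat_vec[OF A X w] by (simp only: x u_eval_vec4[OF half_twist_sq_word])
  have XA: "u_eval half_twist_sq * refl_mat 4 (root_col exotic) (root_row exotic) *\<^sub>v w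
      = u_eval half_twist_sq *\<^sub>v (refl_mat 4 (root_col exotic) (root_row exotic) *\<^sub>v vec4 (a, b, c, d))"
    unfolding assoc_mult_mat_vec[OF X A w] by (simp only: x)
  show "refl_mat 4 (root_col exotic) (root_row exotic) * u_eval half_twist_sq *\<^sub>v w
      = u_eval half_twist_sq * refl_mat 4 (root_col exotic) (root_row exotic) *\<^sub>v w"
    unfolding AX XA refl_mat_vec4 Let_def u_eval_vec4[OF half_twist_sq_word] half_twist_sq_u_step
    by (intro arg_cong[of _ _ vec4])
      (simp add: ex algebra_simps tpow_mult tpow_mult_left tpow_0)
qed

section \<open>The braid group and the quotients by the centres\<close>

lemma equiv_braid_rel: "equiv (braid_words 4) (braid_rel 4)"
  by (rule equivI)
    (auto simp: braid_rel_def refl_on_def sym_def trans_def intro: braid_eq.refl braid_eq.sym braid_eq.trans)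

lemma braid_eq_append: "braid_eq 4 u u' \<Longrightarrow> braid_eq 4 v v' \<Longrightarrow> braid_eq 4 (u @ v) (u' @ v')"
  using braid_eq.congr[of 4 u u' "[]" v] braid_eq.congr[of 4 v v' u' "[]"]
  by (auto intro: braid_eq.trans)

abbreviation braid_class :: "braid_word \<Rightarrow> braid_word set" where
  "braid_class w \<equiv> braid_rel 4 `` {w}"

lemma braid_class_eq_iff:
  "u \<in> braid_words 4 \<Longrightarrow> v \<in> braid_words 4 \<Longrightarrow> braid_class u = braid_class v \<longleftrightarrow> braid_eq 4 u v"
  using eq_equiv_class_iff[OF equiv_braid_rel, of u v] by (simp add: braid_rel_def)

lemma braid_class_mult:
  assumes "u \<in> braid_words 4" "v \<in> braid_words 4"
  shows "braid_class u \<otimes>\<^bsub>braid_group 4\<^esub> braid_class v = braid_class (u @ v)"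
proof -
  have eq: "braid_class (x @ y) = braid_class (u @ v)" if "x \<in> braid_class u" "y \<in> braid_class v" for x y
  proof -
    have "x \<in> braid_words 4" "y \<in> braid_words 4" "braid_eq 4 (x @ y) (u @ v)"
      using that by (auto simp: braid_rel_def intro: braid_eq_append braid_eq.sym)
    then show ?thesis using assms by (subst braid_class_eq_iff) (auto simp: braid_words_def)
  qed
  have "braid_class u \<otimes>\<^bsub>braid_group 4\<^esub> braid_class v
      = (\<Union>x\<in>braid_class u. \<Union>y\<in>braid_class v. braid_class (x @ y))"
    by (simp add: braid_group_def)
  also have "\<dots> = (\<Union>x\<in>braid_class u. \<Union>y\<in>braid_class v. braid_class (u @ v))"
    by (intro SUP_cong HOL.refl eq)
  also have "\<dots> = braid_class (u @ v)"
  proof -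
    have "u \<in> braid_class u" "v \<in> braid_class v"
      using assms by (auto simp: braid_rel_def braid_eq.refl)
    then show ?thesis by blast
  qed
  finally show ?thesis .
qed

lemma square_is_half_twist_sq:
  "(sigma 4 3 \<otimes>\<^bsub>braid_group 4\<^esub> sigma 4 2 \<otimes>\<^bsub>braid_group 4\<^esub> sigma 4 3) [^]\<^bsub>braid_group 4\<^esub> (2::nat)
    = braid_class half_twist_sq"
proof -
  have w: "[(3, True), (2, True), (3, True)] \<in> braid_words 4" "[(3, True)] \<in> braid_words 4"
    "[(2, True)] \<in> braid_words 4" "[(3, True), (2, True)] \<in> braid_words 4" "[] \<in> braid_words 4"
    by (simp_all add: braid_words_def)
  have one: "\<one>\<^bsub>braid_group 4\<^esub> = braid_class []" by (simp add: braid_group_def)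
  have "y [^]\<^bsub>braid_group 4\<^esub> (2::nat) = \<one>\<^bsub>braid_group 4\<^esub> \<otimes>\<^bsub>braid_group 4\<^esub> y \<otimes>\<^bsub>braid_group 4\<^esub> y" for y
    by (simp add: numeral_2_eq_2)
  then show ?thesis
    by (simp add: sigma_def braid_class_mult w one half_twist_sq_def)
qed

lemma the_elem_eval:
  assumes "\<And>u v. braid_eq 4 u v \<Longrightarrow> u \<in> braid_words 4 \<Longrightarrow> v \<in> braid_words 4 \<Longrightarrow> ev u = ev v"
    and "w \<in> braid_words 4"
  shows "the_elem (ev ` braid_class w) = ev w"
proof -
  have "ev ` braid_class w = {ev w}"
    using assms by (auto simp: braid_rel_def intro!: image_eqI[of _ _ w] braid_eq.refl)
  then show ?thesis by simp
qed

lemma carrier_braid_group: "carrier (braid_group 4) = braid_class ` braid_words 4"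
  by (auto simp: braid_group_def quotient_def)

text \<open>Cosets are multiplied as sets of products, and the two products agree because
\<open>z A y X = z X y A\<close> for central \<open>y\<close> and \<open>z\<close>. An equality of cosets gives \<open>A = z P\<close>, since the identity is central.\<close>

lemma central_quotient_witness:
  fixes H :: "laurent mat monoid" and C :: "laurent mat set"
  assumes "group H" and C: "C \<subseteq> carrier H" and one: "\<one>\<^bsub>H\<^esub> \<in> C"
    and G: "G = H\<lparr>carrier := C\<rparr>"
    and A: "A \<in> C" and X: "X \<in> carrier H" and AX: "A \<otimes>\<^bsub>H\<^esub> X = X \<otimes>\<^bsub>H\<^esub> A"
    and ZX: "\<And>z. z \<in> group_center G \<Longrightarrow> z \<otimes>\<^bsub>H\<^esub> X = X \<otimes>\<^bsub>H\<^esub> z"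
    and out: "\<And>P z. P \<in> I \<Longrightarrow> z \<in> group_center G \<Longrightarrow> A \<noteq> z \<otimes>\<^bsub>H\<^esub> P"
  shows "\<exists>A' \<in> carrier (central_quotient G).
    A' \<otimes>\<^bsub>central_quotient G\<^esub> to_central_quotient G X = to_central_quotient G X \<otimes>\<^bsub>central_quotient G\<^esub> A' \<and>
    A' \<notin> to_central_quotient G ` I"
proof (intro bexI conjI)
  interpret group H by fact
  let ?Z = "group_center G"
  have Z: "z \<in> carrier H" "z \<otimes>\<^bsub>H\<^esub> A = A \<otimes>\<^bsub>H\<^esub> z" if "z \<in> ?Z" for z
    using that A C by (auto simp: group_center_def G)
  have cosetG: "to_central_quotient G P = {z \<otimes>\<^bsub>H\<^esub> P | z. z \<in> ?Z}" for P
    by (auto simp: to_central_quotient_def r_coset_def G)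
  have multG: "U \<otimes>\<^bsub>central_quotient G\<^esub> V = {u \<otimes>\<^bsub>H\<^esub> v | u v. u \<in> U \<and> v \<in> V}" for U V
    by (auto simp: central_quotient_def FactGroup_def set_mult_def G)
  show "to_central_quotient G A \<in> carrier (central_quotient G)"
    using A by (auto simp: central_quotient_def FactGroup_def RCOSETS_def to_central_quotient_def G)
  have swap: "z \<otimes>\<^bsub>H\<^esub> A \<otimes>\<^bsub>H\<^esub> (y \<otimes>\<^bsub>H\<^esub> X) = z \<otimes>\<^bsub>H\<^esub> X \<otimes>\<^bsub>H\<^esub> (y \<otimes>\<^bsub>H\<^esub> A)" if "z \<in> ?Z" "y \<in> ?Z" for z y
  proof -
    have c: "z \<in> carrier H" "y \<in> carrier H" "A \<in> carrier H" using Z that A C by auto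
    have "A \<otimes>\<^bsub>H\<^esub> (y \<otimes>\<^bsub>H\<^esub> X) = y \<otimes>\<^bsub>H\<^esub> (A \<otimes>\<^bsub>H\<^esub> X)"
      using c X Z(2)[OF that(2)] by (simp flip: m_assoc)
    also have "\<dots> = X \<otimes>\<^bsub>H\<^esub> (y \<otimes>\<^bsub>H\<^esub> A)"
      using c X ZX[OF that(2)] by (simp add: AX flip: m_assoc)
    finally show ?thesis using c X by (simp add: m_assoc)
  qed
  show "to_central_quotient G A \<otimes>\<^bsub>central_quotient G\<^esub> to_central_quotient G X
      = to_central_quotient G X \<otimes>\<^bsub>central_quotient G\<^esub> to_central_quotient G A"
  proof (rule Set.set_eqI)
    fix m
    have "m \<in> to_central_quotient G A \<otimes>\<^bsub>central_quotient G\<^esub> to_central_quotient G X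
        \<longleftrightarrow> (\<exists>z\<in>?Z. \<exists>y\<in>?Z. m = z \<otimes>\<^bsub>H\<^esub> A \<otimes>\<^bsub>H\<^esub> (y \<otimes>\<^bsub>H\<^esub> X))"
      unfolding multG cosetG by blast
    also have "\<dots> \<longleftrightarrow> (\<exists>z\<in>?Z. \<exists>y\<in>?Z. m = z \<otimes>\<^bsub>H\<^esub> X \<otimes>\<^bsub>H\<^esub> (y \<otimes>\<^bsub>H\<^esub> A))"
      using swap by simp
    also have "\<dots> \<longleftrightarrow> m \<in> to_central_quotient G X \<otimes>\<^bsub>central_quotient G\<^esub> to_central_quotient G A"
      unfolding multG cosetG by blast
    finally show "m \<in> to_central_quotient G A \<otimes>\<^bsub>central_quotient G\<^esub> to_central_quotient G X
        \<longleftrightarrow> m \<in> to_central_quotient G X \<otimes>\<^bsub>central_quotient G\<^esub> to_central_quotient G A" .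
  qed
  show "to_central_quotient G A \<notin> to_central_quotient G ` I"
  proof
    assume "to_central_quotient G A \<in> to_central_quotient G ` I"
    then obtain P where P: "P \<in> I" "to_central_quotient G A = to_central_quotient G P" by auto
    have "\<one>\<^bsub>H\<^esub> \<in> ?Z" using one C by (auto simp: group_center_def G subset_iff)
    then have "A \<in> to_central_quotient G A" using A C unfolding cosetG by force
    then have "A \<in> to_central_quotient G P" using P by simp
    then show False using out[OF P(1)] unfolding cosetG by blast
  qed
qed

text \<open>If the reflection were \<open>z P\<close> with \<open>P\<close> the matrix of a word \<open>w\<close>, then cancelling the central factor \<open>z\<close>
shows that \<open>P\<close> commutes with the matrix of the twist. Injectivity turns this into a relation between
braids, to which \<open>exotic_not_central_multiple\<close> applies.\<close>

lemma (in burau_model) exotic_outside: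
  assumes f: "\<And>i. i \<in> {1,2,3} \<Longrightarrow> f i = refl_mat n (col (unit_root i)) (row (unit_root i))"
    and C: "C \<subseteq> carrier (GL n)" "1\<^sub>m n \<in> C"
    and G: "G = (GL n)\<lparr>carrier := C\<rparr>"
    and gens: "\<And>i. i \<in> {1,2,3} \<Longrightarrow> f i \<in> C"
    and A: "refl_mat n (col exotic) (row exotic) \<in> C"
    and act: "\<And>w v. w \<in> braid_words 4 \<Longrightarrow> word_eval (GL n) f w *\<^sub>v embed v = embed (foldr burau_step w v)"
    and cong: "\<And>u v. braid_eq 4 u v \<Longrightarrow> u \<in> braid_words 4 \<Longrightarrow> v \<in> braid_words 4 \<Longrightarrow>
      word_eval (GL n) f u = word_eval (GL n) f v"
    and AX: "refl_mat n (col exotic) (row exotic) * word_eval (GL n) f half_twist_sq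
      = word_eval (GL n) f half_twist_sq * refl_mat n (col exotic) (row exotic)"
    and inj: "inj_on (\<lambda>X. the_elem (word_eval (GL n) f ` X)) (carrier (braid_group 4))"
  shows "\<exists>A \<in> carrier (central_quotient G).
    A \<otimes>\<^bsub>central_quotient G\<^esub> to_central_quotient G (word_eval (GL n) f half_twist_sq)
      = to_central_quotient G (word_eval (GL n) f half_twist_sq) \<otimes>\<^bsub>central_quotient G\<^esub> A \<and>
    A \<notin> to_central_quotient G ` (word_eval (GL n) f ` braid_words 4)"
proof -
  interpret GL: group "GL n" by (rule group_GL)
  let ?ev = "word_eval (GL n) f" and ?A = "refl_mat n (col exotic) (row exotic)"
  have fGL: "\<And>i. i \<in> {1,2,3} \<Longrightarrow> f i \<in> carrier (GL n)" using gens C by auto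
  have ev: "?ev w \<in> carrier (GL n)" if "w \<in> braid_words 4" for w
    by (rule word_eval_carrier[where g = f, OF group_GL fGL that])
  have evapp: "?ev (u @ v) = ?ev u * ?ev v" if "u \<in> braid_words 4" "v \<in> braid_words 4" for u v
    using word_eval_append[where g = f, OF group_GL fGL that] by (simp add: GL_simps)
  have ZX: "z \<otimes>\<^bsub>GL n\<^esub> ?ev half_twist_sq = ?ev half_twist_sq \<otimes>\<^bsub>GL n\<^esub> z"
    if "z \<in> group_center G" for z
  proof -
    have z: "z \<in> carrier (GL n)" "z \<otimes>\<^bsub>GL n\<^esub> f 2 = f 2 \<otimes>\<^bsub>GL n\<^esub> z" "z \<otimes>\<^bsub>GL n\<^esub> f 3 = f 3 \<otimes>\<^bsub>GL n\<^esub> z"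
      using that gens C by (auto simp: group_center_def G)
    have f23: "f 2 \<in> carrier (GL n)" "f 3 \<in> carrier (GL n)" using fGL by auto
    have c: "z \<otimes>\<^bsub>GL n\<^esub> (g \<otimes>\<^bsub>GL n\<^esub> h) = (g \<otimes>\<^bsub>GL n\<^esub> h) \<otimes>\<^bsub>GL n\<^esub> z"
      if "z \<otimes>\<^bsub>GL n\<^esub> g = g \<otimes>\<^bsub>GL n\<^esub> z" "z \<otimes>\<^bsub>GL n\<^esub> h = h \<otimes>\<^bsub>GL n\<^esub> z" "g \<in> carrier (GL n)" "h \<in> carrier (GL n)" for g h
      using that z(1) by (metis GL.m_assoc)
    show ?thesis
      unfolding half_twist_sq_def word_eval_def using f23 z
      by (simp only: foldr.simps comp_apply id_apply prod.case if_True) (intro c; simp)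
  qed
  show ?thesis
  proof (rule central_quotient_witness[OF group_GL C(1) _ G A ev[OF half_twist_sq_word] _ ZX])
    show "\<one>\<^bsub>GL n\<^esub> \<in> C" using C by (simp add: GL_simps)
    show "?A \<otimes>\<^bsub>GL n\<^esub> ?ev half_twist_sq = ?ev half_twist_sq \<otimes>\<^bsub>GL n\<^esub> ?A"
      using AX by (simp add: GL_simps)
    fix P z assume "P \<in> ?ev ` braid_words 4" and z: "z \<in> group_center G"
    then obtain w where w: "w \<in> braid_words 4" "P = ?ev w" by blast
    have zc: "z \<in> carrier (GL n)" "\<And>g. g \<in> C \<Longrightarrow> z * g = g * z"
      using z C by (auto simp: group_center_def G GL_simps)
    show "?A \<noteq> z \<otimes>\<^bsub>GL n\<^esub> P"
    proof
      assume AzP: "?A = z \<otimes>\<^bsub>GL n\<^esub> P"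
      let ?x = "half_twist_sq"
      have x: "?ev ?x \<in> carrier (GL n)" by (rule ev[OF half_twist_sq_word])
      have p: "?ev w \<in> carrier (GL n)" by (rule ev[OF w(1)])
      have "z \<otimes>\<^bsub>GL n\<^esub> (?ev w \<otimes>\<^bsub>GL n\<^esub> ?ev ?x) = ?A \<otimes>\<^bsub>GL n\<^esub> ?ev ?x"
        using zc x p by (simp add: AzP w GL.m_assoc)
      also have "\<dots> = ?ev ?x \<otimes>\<^bsub>GL n\<^esub> ?A" using AX by (simp add: GL_simps)
      also have "\<dots> = z \<otimes>\<^bsub>GL n\<^esub> (?ev ?x \<otimes>\<^bsub>GL n\<^esub> ?ev w)"
        using zc x p ZX[OF z] by (simp add: AzP w flip: GL.m_assoc)
      finally have "?ev w \<otimes>\<^bsub>GL n\<^esub> ?ev ?x = ?ev ?x \<otimes>\<^bsub>GL n\<^esub> ?ev w"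
        using zc x p by (simp add: GL.Units_eq GL.Units_l_cancel)
      then have eveq: "?ev (w @ ?x) = ?ev (?x @ w)"
        by (simp add: evapp w half_twist_sq_word GL_simps)
      have wx: "w @ ?x \<in> braid_words 4" "?x @ w \<in> braid_words 4"
        using w half_twist_sq_word by (auto simp: braid_words_def)
      have "braid_class (w @ ?x) = braid_class (?x @ w)"
        by (rule inj_onD[OF inj]) (use wx eveq the_elem_eval[OF cong] in \<open>auto simp: carrier_braid_group\<close>)
      then have "braid_eq 4 (w @ ?x) (?x @ w)"
        using braid_class_eq_iff[OF wx] by simp
      moreover have "?A = z * ?ev w" using AzP w by (simp add: GL_simps)
      moreover have "z * refl_mat n (col (unit_root i)) (row (unit_root i)) = refl_mat n (col (unit_root i)) (row (unit_root i)) * z"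
        if "i \<in> {1,2,3}" for i
        using zc(2)[OF gens[OF that]] f[OF that] by simp
      ultimately show False
        using exotic_not_central_multiple[OF GL_carrier_mat[OF zc(1)] _ w(1) _ GL_carrier_mat[OF p] act[OF w(1)]]
        by blast
    qed
  qed
qed

lemma one_mat_Gamma: "1\<^sub>m 4 \<in> carrier (Gamma 4)" "1\<^sub>m 3 \<in> carrier (Gamma_red 4)"
proof -
  have J: "J_mat 4 \<in> carrier_mat 4 4" and v: "v_row 4 \<in> carrier_mat 1 4" and o: "ones_col 4 \<in> carrier_mat 4 1"
    by (simp_all add: J_mat_def v_row_def ones_col_def mat1_def)
  have "map_mat laurent_bar (1\<^sub>m 4) = 1\<^sub>m 4"
    by (rule eq_matI) auto
  moreover have "map_mat laurent_at_1 (1\<^sub>m 4) \<in> permutation_matrices 4"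
    by (rule transposition_matrix[of 0 _ 0]) (auto simp: laurent_at_1_eval)
  moreover have "1\<^sub>m 4 \<in> carrier (GL 4)" "1\<^sub>m 3 \<in> carrier (GL 3)"
    using group.is_monoid[OF group_GL, THEN monoid.one_closed, of 4]
      group.is_monoid[OF group_GL, THEN monoid.one_closed, of 3] by (simp_all add: GL_simps)
  ultimately show 1: "1\<^sub>m 4 \<in> carrier (Gamma 4)"
    using J v o by (simp add: Gamma_def)
  then show "1\<^sub>m 3 \<in> carrier (Gamma_red 4)"
    using \<open>1\<^sub>m 3 \<in> carrier (GL 3)\<close> W_mat_carrier
    by (auto simp: Gamma_red_def intro!: bexI[OF _ 1])
qed

theorem theorem1p1:
  "let x = (sigma 4 3 \<otimes>\<^bsub>braid_group 4\<^esub> sigma 4 2 \<otimes>\<^bsub>braid_group 4\<^esub> sigma 4 3)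
             [^]\<^bsub>braid_group 4\<^esub> (2::nat)
   in (inj_on (burau_u 4) (carrier (braid_group 4)) \<longrightarrow>
        (\<exists>A \<in> carrier (central_quotient (Gamma 4)).
           A \<otimes>\<^bsub>central_quotient (Gamma 4)\<^esub> burau_u_bar 4 x =
             burau_u_bar 4 x \<otimes>\<^bsub>central_quotient (Gamma 4)\<^esub> A \<and>
           A \<notin> burau_u_bar 4 ` carrier (braid_group 4))) \<and>
      (inj_on (burau_r 4) (carrier (braid_group 4)) \<longrightarrow>
        (\<exists>A \<in> carrier (central_quotient (Gamma_red 4)).
           A \<otimes>\<^bsub>central_quotient (Gamma_red 4)\<^esub> burau_r_bar 4 x =
             burau_r_bar 4 x \<otimes>\<^bsub>central_quotient (Gamma_red 4)\<^esub> A \<and>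
           A \<notin> burau_r_bar 4 ` carrier (braid_group 4)))"
proof -
  have u: "burau_u 4 (braid_class w) = u_eval w" and r: "burau_r 4 (braid_class w) = r_eval w"
    if "w \<in> braid_words 4" for w
    using the_elem_eval[of u_eval, OF u_eval_cong that] the_elem_eval[of r_eval, OF r_eval_cong that]
    by (simp_all add: burau_u_def burau_r_def)
  have u_im: "burau_u_bar 4 ` carrier (braid_group 4) = to_central_quotient (Gamma 4) ` (u_eval ` braid_words 4)"
    and r_im: "burau_r_bar 4 ` carrier (braid_group 4) = to_central_quotient (Gamma_red 4) ` (r_eval ` braid_words 4)"
    by (auto simp: carrier_braid_group burau_u_bar_def burau_r_bar_def u r image_iff)
  have x: "burau_u_bar 4 (braid_class half_twist_sq) = to_central_quotient (Gamma 4) (u_eval half_twist_sq)"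
    "burau_r_bar 4 (braid_class half_twist_sq) = to_central_quotient (Gamma_red 4) (r_eval half_twist_sq)"
    by (simp_all add: burau_u_bar_def burau_r_bar_def u r half_twist_sq_word)
  have "\<exists>A \<in> carrier (central_quotient (Gamma 4)).
        A \<otimes>\<^bsub>central_quotient (Gamma 4)\<^esub> to_central_quotient (Gamma 4) (u_eval half_twist_sq) =
          to_central_quotient (Gamma 4) (u_eval half_twist_sq) \<otimes>\<^bsub>central_quotient (Gamma 4)\<^esub> A \<and>
        A \<notin> to_central_quotient (Gamma 4) ` (u_eval ` braid_words 4)"
    if "inj_on (burau_u 4) (carrier (braid_group 4))"
  proof (rule unr.exotic_outside[where f = "burau_u_gen 4" and C = "carrier (Gamma 4)",
        OF burau_u_gen_refl Gamma_GL(1) one_mat_Gamma(1) _ burau_u_gen_Gamma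
          refl_root_Gamma[OF is_root_exotic exotic_perm] u_eval_embed u_eval_cong exotic_commute_unr])
    show "Gamma 4 = (GL 4)\<lparr>carrier := carrier (Gamma 4)\<rparr>" by (simp add: Gamma_def)
    show "inj_on (\<lambda>X. the_elem (u_eval ` X)) (carrier (braid_group 4))"
      using that by (simp only: burau_u_def[abs_def])
  qed
  moreover have "\<exists>A \<in> carrier (central_quotient (Gamma_red 4)).
        A \<otimes>\<^bsub>central_quotient (Gamma_red 4)\<^esub> to_central_quotient (Gamma_red 4) (r_eval half_twist_sq) =
          to_central_quotient (Gamma_red 4) (r_eval half_twist_sq) \<otimes>\<^bsub>central_quotient (Gamma_red 4)\<^esub> A \<and>
        A \<notin> to_central_quotient (Gamma_red 4) ` (r_eval ` braid_words 4)"
    if "inj_on (burau_r 4) (carrier (braid_group 4))"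
  proof (rule red.exotic_outside[where f = "burau_r_gen 4" and C = "carrier (Gamma_red 4)",
        OF burau_r_gen_refl _ one_mat_Gamma(2) _ burau_r_gen_Gamma
          refl_root_Gamma_red[OF is_root_exotic exotic_perm] r_eval_embed r_eval_cong exotic_commute_red])
    show "carrier (Gamma_red 4) \<subseteq> carrier (GL 3)" using Gamma_GL(2)[of 4] by simp
    show "Gamma_red 4 = (GL 3)\<lparr>carrier := carrier (Gamma_red 4)\<rparr>" by (simp add: Gamma_red_def)
    show "inj_on (\<lambda>X. the_elem (r_eval ` X)) (carrier (braid_group 4))"
      using that by (simp add: burau_r_def[abs_def])
  qed
  ultimately show ?thesis
    unfolding Let_def square_is_half_twist_sq u_im r_im x by blast
qed

end
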